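(* Let $k$ be any field of characteristic $p>0$, and let $f\in k[x_1,\dots,x_n]$ be a homogeneous polynomial of degree $d\geq 2$ that is reduced over the algebraic closure of $k$. Then $$\operatorname{fpt}(f)\ \geq\ \frac{1}{d-1}.$$ Furthermore, equality $\operatorname{fpt}(f)=\frac{1}{d-1}$ holds if and only if $d=q+1$ for some power $q=p^e$ of $p$ (with $e\geq 0$) such that $f\in\langle x_1^{q},\dots,x_n^{q}\rangle$.
   Context: For a field $k$ of characteristic $p>0$, let $\mathfrak m=\langle x_1,\dots,x_n\rangle\subset k[x_1,\dots,x_n]$ and $\mathfrak m^{[p^e]}=\langle x_1^{p^e},\dots,x_n^{p^e}\rangle$. The $F$-pure threshold of $f$ (at $\mathfrak m$) is $$\operatorname{fpt}(f)=\sup\left\{\tfrac{N}{p^e}\ \middle|\ f^N\notin\mathfrak m^{[p^e]}\right\}=\inf\left\{\tfrac{N}{p^e}\ \middle|\ f^N\in\mathfrak m^{[p^e]}\right\},$$ where $N$ and $e$ range over nonnegative integers. "Reduced over the algebraic closure" means that $f$ has no repeated irreducible factors in $\overline{k}[x_1,\dots,x_n]$. *)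

theory Defs
  imports
    "HOL-Library.Poly_Mapping"
    "HOL-Library.Extended_Real"
    "HOL-Algebra.Algebraic_Closure_Type"
    "HOL-Computational_Algebra.Factorial_Ring"
begin

text \<open>
  The polynomial ring \<open>k[x\<^sub>1, \<dots>, x\<^sub>n]\<close>: finitely supported functions from exponent vectors to
  coefficients, with the convolution product of \<^theory>\<open>HOL-Library.Poly_Mapping\<close>.  The variables
  are indexed by a type \<open>'n\<close>, which is required to be finite wherever it matters; \<open>n = CARD('n) \<ge> 1\<close>.
\<close>

type_synonym ('n, 'a) mpoly = "('n \<Rightarrow>\<^sub>0 nat) \<Rightarrow>\<^sub>0 'a"

definition var :: "'n \<Rightarrow> ('n, 'a::comm_ring_1) mpoly" where
  "var i = Poly_Mapping.single (Poly_Mapping.single i 1) 1"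

text \<open>As usual, the zero polynomial is homogeneous of every degree.\<close>

definition homogeneous_of_degree :: "nat \<Rightarrow> ('n::finite, 'a::zero) mpoly \<Rightarrow> bool" where
  "homogeneous_of_degree d f \<longleftrightarrow>
     (\<forall>m\<in>Poly_Mapping.keys f. (\<Sum>i\<in>UNIV. Poly_Mapping.lookup m i) = d)"

text \<open>A commutative ring is a module over itself, and its ideals are the submodules.\<close>

definition ideal_generated_by :: "'r::comm_ring_1 set \<Rightarrow> 'r set" where
  "ideal_generated_by S = Modules.module.span (*) S"

lemma module_self: "Modules.module ((*) :: 'r::comm_ring_1 \<Rightarrow> 'r \<Rightarrow> 'r)"
  by standard (simp_all add: algebra_simps)

definition var_power_ideal :: "nat \<Rightarrow> ('n::finite, 'a::comm_ring_1) mpoly set" where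
  "var_power_ideal q = ideal_generated_by (range (\<lambda>i. var i ^ q))"

text \<open>
  The value is an extended real so that the supremum is the correct one also when
  \<open>f \<notin> \<langle>x\<^sub>1, \<dots>, x\<^sub>n\<rangle>\<close>, where it is \<open>\<infinity>\<close>.
\<close>

definition fpt :: "('n::finite, 'a::field) mpoly \<Rightarrow> ereal" where
  "fpt f = Sup {ereal (real N / real (CHAR('a) ^ e)) | N e. f ^ N \<notin> var_power_ideal (CHAR('a) ^ e)}"

definition reduced_over_alg_closure :: "('n::finite, 'a::field) mpoly \<Rightarrow> bool" where
  "reduced_over_alg_closure f \<longleftrightarrow>
     (\<forall>g :: ('n, 'a alg_closure) mpoly. irreducible g \<longrightarrow> \<not> g ^ 2 dvd Poly_Mapping.map to_ac f)"

end

theory Submission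
  imports Defs
begin

text \<open>
  The membership \<open>f\<^sup>N \<in> \<langle>x\<^sub>1\<^sup>q, \<dots>, x\<^sub>n\<^sup>q\<rangle>\<close> persists on restricting \<open>f\<close> to a plane, and since \<open>f\<close> is
  reduced over the algebraic closure, some plane makes it a binary form \<open>F\<close> of degree \<open>d\<close> without
  multiple factors.  Let \<open>N\<close> be minimal with \<open>F\<^sup>N \<in> \<langle>x\<^sup>q, y\<^sup>q\<rangle>\<close>.  If \<open>p\<close> divides \<open>N\<close>, then \<open>N\<close> and \<open>q\<close>
  can both be divided by \<open>p\<close>.  Otherwise differentiation gives
  \<open>F\<^bsup>N-1\<^esup> \<cdot> (F, F\<^sub>x, F\<^sub>y) \<subseteq> \<langle>x\<^sup>q, y\<^sup>q\<rangle>\<close>; the ideal \<open>(F, F\<^sub>x, F\<^sub>y)\<close> contains all forms of degree \<open>2d - 3\<close>,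
  while the socle of \<open>k[x, y]/\<langle>x\<^sup>q, y\<^sup>q\<rangle>\<close> sits in degree \<open>2q - 2\<close>, so that \<open>N d + d \<ge> 2 q + 2\<close>.
  Together with \<open>N \<ge> 1\<close> this implies \<open>N/q \<ge> 1/(d - 1)\<close>, with a gap unless \<open>d - 1\<close> is a power of \<open>p\<close>.
\<close>

section \<open>Substitution homomorphisms\<close>

text \<open>The main obstacle is finding the plane. In characteristic p, a form without repeated
  factors over k may restrict with multiple factors to every plane, since an irreducible polynomial
  can have all partial derivatives zero. Over an algebraically closed field such a polynomial is a
  p-th power, so an irreducible one always has a nonzero derivative along the generic line X + T U.
  Comparing f(X + T U) with its T-derivative needs irreducibles to be prime; hence the development
  of unique factorization. A nonzero element free of T in the ideal of these two polynomials acts as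
  a discriminant: lines at which it does not vanish are good. The lower bounds 1 and (2q + 2 - d)/d
  on N agree exactly at q = d - 1, where they give N/q = 1/(d - 1); for d > 2, all other q leave a
  uniform gap. If q = d - 1 is a power of p, two powers of f decide equality: f in m^[q] gives
  fpt(f) <= 1/q by Frobenius, while otherwise f^(q+1) is not in m^[q^2] and fpt(f) >= (q + 1)/q^2 >
  1/q.\<close>

locale ring_hom_fun =
  fixes h :: "'r::comm_ring_1 \<Rightarrow> 's::comm_ring_1"
  assumes hom_add: "h (a + b) = h a + h b"
    and hom_mult: "h (a * b) = h a * h b"
    and hom_one: "h 1 = 1"
begin

lemma hom_zero: "h 0 = 0"
  using hom_add[of 0 0] by simp

lemma hom_uminus: "h (- a) = - h a"
  using hom_add[of a "- a"] by (simp add: hom_zero eq_neg_iff_add_eq_0 add.commute)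

lemma hom_diff: "h (a - b) = h a - h b"
  using hom_add[of a "- b"] by (simp add: hom_uminus)

lemma hom_sum: "h (sum g A) = (\<Sum>i\<in>A. h (g i))"
  by (induction A rule: infinite_finite_induct) (simp_all add: hom_zero hom_add)

lemma hom_prod: "h (prod g A) = (\<Prod>i\<in>A. h (g i))"
  by (induction A rule: infinite_finite_induct) (simp_all add: hom_one hom_mult)

lemma hom_power: "h (a ^ n) = h a ^ n"
  by (induction n) (simp_all add: hom_one hom_mult)

lemma hom_of_nat: "h (of_nat n) = of_nat n"
  by (induction n) (simp_all add: hom_zero hom_one hom_add)

lemma hom_dvd: "a dvd b \<Longrightarrow> h a dvd h b"
  by (auto simp: dvd_def hom_mult)

lemma hom_unit: "a dvd 1 \<Longrightarrow> h a dvd 1"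
  using hom_dvd[of a 1] by (simp add: hom_one)

end

lemma ring_hom_fun_comp:
  assumes "ring_hom_fun g" "ring_hom_fun h"
  shows "ring_hom_fun (\<lambda>x. g (h x))"
proof -
  interpret g: ring_hom_fun g by fact
  interpret h: ring_hom_fun h by fact
  show ?thesis
    by standard (simp_all add: g.hom_add g.hom_mult g.hom_one h.hom_add h.hom_mult h.hom_one)
qed

lemma ring_hom_fun_id: "ring_hom_fun (\<lambda>x. x)"
  by standard auto

lemma ring_hom_fun_poly: "ring_hom_fun (\<lambda>P. poly P a)"
  by standard auto

lemma ring_hom_fun_const_poly: "ring_hom_fun (\<lambda>c. [:c:])"
  by standard (auto simp: one_pCons)

lemma ring_hom_fun_pcompose: "ring_hom_fun (\<lambda>P. pcompose P Q)"
  by standard (auto simp: pcompose_add pcompose_mult pcompose_1)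

lemma ring_hom_fun_map_poly:
  assumes "ring_hom_fun h"
  shows "ring_hom_fun (map_poly h)"
proof -
  interpret ring_hom_fun h by fact
  show ?thesis
  proof
    show "map_poly h (p + q) = map_poly h p + map_poly h q" for p q
      by (intro poly_eqI) (simp add: coeff_map_poly hom_zero hom_add)
    show "map_poly h (p * q) = map_poly h p * map_poly h q" for p q
      by (intro poly_eqI) (simp add: coeff_map_poly hom_zero coeff_mult hom_sum hom_mult)
    show "map_poly h 1 = 1"
      by (simp add: one_pCons map_poly_pCons hom_zero hom_one)
  qed
qed

section \<open>Evaluation homomorphisms on multivariate polynomials\<close>

definition mconst :: "'a \<Rightarrow> ('n, 'a::comm_ring_1) mpoly" where
  "mconst c = Poly_Mapping.single 0 c"

definition monom_eval :: "('n \<Rightarrow> 'b::comm_ring_1) \<Rightarrow> ('n \<Rightarrow>\<^sub>0 nat) \<Rightarrow> 'b" where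
  "monom_eval v m = (\<Prod>i\<in>Poly_Mapping.keys m. v i ^ Poly_Mapping.lookup m i)"

definition mp_eval :: "('a::comm_ring_1 \<Rightarrow> 'b::comm_ring_1) \<Rightarrow> ('n \<Rightarrow> 'b) \<Rightarrow> ('n, 'a) mpoly \<Rightarrow> 'b" where
  "mp_eval \<phi> v p = (\<Sum>m\<in>Poly_Mapping.keys p. \<phi> (Poly_Mapping.lookup p m) * monom_eval v m)"

lemma ring_hom_fun_mconst: "ring_hom_fun mconst"
  by standard (simp_all add: mconst_def single_add mult_single)

lemma monom_eval_superset:
  assumes "finite A" "Poly_Mapping.keys m \<subseteq> A"
  shows "monom_eval v m = (\<Prod>i\<in>A. v i ^ Poly_Mapping.lookup m i)"
  unfolding monom_eval_def using assms by (intro prod.mono_neutral_left) (auto simp: in_keys_iff)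

lemma monom_eval_zero [simp]: "monom_eval v 0 = 1"
  by (simp add: monom_eval_def)

lemma monom_eval_single [simp]: "monom_eval v (Poly_Mapping.single i k) = v i ^ k"
  by (cases "k = 0") (simp_all add: monom_eval_def)

lemma monom_eval_add: "monom_eval v (m + n) = monom_eval v m * monom_eval v n"
proof -
  let ?A = "Poly_Mapping.keys m \<union> Poly_Mapping.keys n"
  have "monom_eval v (m + n) = (\<Prod>i\<in>?A. v i ^ Poly_Mapping.lookup (m + n) i)"
    using Poly_Mapping.keys_add[of m n] by (intro monom_eval_superset) auto
  also have "\<dots> = (\<Prod>i\<in>?A. v i ^ Poly_Mapping.lookup m i) * (\<Prod>i\<in>?A. v i ^ Poly_Mapping.lookup n i)"
    by (simp add: lookup_add power_add prod.distrib)
  also have "\<dots> = monom_eval v m * monom_eval v n"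
    by (simp add: monom_eval_superset[of ?A])
  finally show ?thesis .
qed

lemma poly_mapping_sum_single:
  fixes p :: "'k \<Rightarrow>\<^sub>0 'b::comm_monoid_add"
  shows "(\<Sum>m\<in>Poly_Mapping.keys p. Poly_Mapping.single m (Poly_Mapping.lookup p m)) = p"
proof (rule poly_mapping_eqI)
  fix k
  show "Poly_Mapping.lookup (\<Sum>m\<in>Poly_Mapping.keys p. Poly_Mapping.single m (Poly_Mapping.lookup p m)) k
      = Poly_Mapping.lookup p k"
    by (simp add: lookup_sum lookup_single when_def in_keys_iff)
qed

lemma poly_mapping_single_induct [case_names zero single add]:
  fixes p :: "'k \<Rightarrow>\<^sub>0 'b::comm_monoid_add"
  assumes "P 0" "\<And>m c. P (Poly_Mapping.single m c)" "\<And>p q. P p \<Longrightarrow> P q \<Longrightarrow> P (p + q)"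
  shows "P p"
proof -
  have "P (\<Sum>m\<in>A. Poly_Mapping.single m (Poly_Mapping.lookup p m))" for A
    by (induction A rule: infinite_finite_induct) (use assms in auto)
  from this[of "Poly_Mapping.keys p"] show ?thesis by (simp add: poly_mapping_sum_single)
qed

lemma var_power: "(var i :: ('n, 'a::comm_ring_1) mpoly) ^ k = Poly_Mapping.single (Poly_Mapping.single i k) 1"
  by (induction k) (simp_all add: var_def mult_single flip: single_add)

lemma monomial_eq_prod:
  fixes c :: "'a::comm_ring_1" and m :: "'n \<Rightarrow>\<^sub>0 nat"
  shows "Poly_Mapping.single m c = mconst c * monom_eval var m"
proof -
  have "monom_eval var m = (Poly_Mapping.single m 1 :: ('n,'a) mpoly)"
  proof (induction m rule: poly_mapping_single_induct)
    case (add p q)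
    then show ?case by (simp add: monom_eval_add mult_single)
  qed (simp_all add: var_power)
  then show ?thesis by (simp add: mconst_def mult_single)
qed

context
  fixes \<phi> :: "'a::comm_ring_1 \<Rightarrow> 'b::comm_ring_1"
  assumes \<phi>: "ring_hom_fun \<phi>"
begin

interpretation ring_hom_fun \<phi> by (rule \<phi>)

lemma mp_eval_superset:
  assumes "finite A" "Poly_Mapping.keys p \<subseteq> A"
  shows "mp_eval \<phi> v p = (\<Sum>m\<in>A. \<phi> (Poly_Mapping.lookup p m) * monom_eval v m)"
  unfolding mp_eval_def using assms
  by (intro sum.mono_neutral_left) (auto simp: in_keys_iff hom_zero)

lemma mp_eval_single [simp]: "mp_eval \<phi> v (Poly_Mapping.single m c) = \<phi> c * monom_eval v m"
  by (cases "c = 0") (simp_all add: mp_eval_def hom_zero)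

lemma mp_eval_mconst [simp]: "mp_eval \<phi> v (mconst c) = \<phi> c"
  by (simp add: mconst_def)

lemma mp_eval_var [simp]: "mp_eval \<phi> v (var i) = v i"
  by (simp add: var_def hom_one)

lemma mp_eval_add: "mp_eval \<phi> v (p + q) = mp_eval \<phi> v p + mp_eval \<phi> v q"
proof -
  let ?A = "Poly_Mapping.keys p \<union> Poly_Mapping.keys q"
  have "mp_eval \<phi> v (p + q) = (\<Sum>m\<in>?A. \<phi> (Poly_Mapping.lookup (p + q) m) * monom_eval v m)"
    using Poly_Mapping.keys_add[of p q] by (intro mp_eval_superset) auto
  then show ?thesis
    by (simp add: mp_eval_superset[of ?A] lookup_add hom_add algebra_simps sum.distrib)
qed

lemma ring_hom_fun_mp_eval: "ring_hom_fun (mp_eval \<phi> v)"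
proof
  show "mp_eval \<phi> v (p + q) = mp_eval \<phi> v p + mp_eval \<phi> v q" for p q
    by (rule mp_eval_add)
  have z: "mp_eval \<phi> v 0 = 0" by (simp add: mp_eval_def)
  have 1: "mp_eval \<phi> v (Poly_Mapping.single m c * q) =
      mp_eval \<phi> v (Poly_Mapping.single m c) * mp_eval \<phi> v q" for m c q
    by (induction q rule: poly_mapping_single_induct)
       (simp_all add: z mp_eval_add mult_single monom_eval_add hom_mult distrib_left distrib_right mult_ac)
  show "mp_eval \<phi> v (p * q) = mp_eval \<phi> v p * mp_eval \<phi> v q" for p q
    by (induction p rule: poly_mapping_single_induct)
       (simp_all add: z 1 mp_eval_add distrib_right)
  show "mp_eval \<phi> v 1 = 1"
    unfolding single_one[symmetric] by (simp add: hom_one del: single_one)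
qed

end

text \<open>Every substitution below is packaged as a \<open>ring_hom_fun\<close> so that identities
  between composites of substitutions can be checked on constants and variables alone.\<close>

lemma mpoly_hom_eqI:
  assumes "ring_hom_fun g" "ring_hom_fun h"
    and "\<And>c. g (mconst c) = h (mconst c)" "\<And>i. g (var i) = h (var i)"
  shows "g p = h p"
proof -
  interpret g: ring_hom_fun g by fact
  interpret h: ring_hom_fun h by fact
  show ?thesis
  proof (induction p rule: poly_mapping_single_induct)
    case (single m c)
    then show ?case
      by (simp add: monomial_eq_prod g.hom_mult h.hom_mult monom_eval_def g.hom_prod h.hom_prod
            g.hom_power h.hom_power assms)
  qed (simp_all add: g.hom_zero h.hom_zero g.hom_add h.hom_add)
qed

section \<open>Polynomials as univariate polynomials in one of the variables\<close>

text \<open>The coefficients stay in the same polynomial ring, where they are free of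
  \<open>var x\<close>. Thus singling out one variable never changes the type of the
  variables.\<close>

definition as_upoly :: "'n \<Rightarrow> ('n, 'a::comm_ring_1) mpoly \<Rightarrow> ('n, 'a) mpoly poly" where
  "as_upoly x = mp_eval (\<lambda>c. [:mconst c:]) (\<lambda>i. if i = x then [:0, 1:] else [:var i:])"

text \<open>The substitution of T x_i for every x_i: the coefficient of T^k is the homogeneous
  component of degree k, so additivity of the total degree is inherited from univariate
  polynomials.\<close>

definition total_upoly :: "('n, 'a::comm_ring_1) mpoly \<Rightarrow> ('n, 'a) mpoly poly" where
  "total_upoly = mp_eval (\<lambda>c. [:mconst c:]) (\<lambda>i. [:0, var i:])"

abbreviation vdeg :: "'n \<Rightarrow> ('n, 'a::comm_ring_1) mpoly \<Rightarrow> nat" where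
  "vdeg x p \<equiv> degree (as_upoly x p)"

abbreviation tdeg :: "('n, 'a::comm_ring_1) mpoly \<Rightarrow> nat" where
  "tdeg p \<equiv> degree (total_upoly p)"

lemma ring_hom_fun_const_mconst: "ring_hom_fun (\<lambda>c. [:mconst c:])"
  by (rule ring_hom_fun_comp[OF ring_hom_fun_const_poly ring_hom_fun_mconst])

interpretation as_upoly: ring_hom_fun "as_upoly x"
  unfolding as_upoly_def by (rule ring_hom_fun_mp_eval[OF ring_hom_fun_const_mconst])

interpretation total_upoly: ring_hom_fun total_upoly
  unfolding total_upoly_def by (rule ring_hom_fun_mp_eval[OF ring_hom_fun_const_mconst])

lemma as_upoly_mconst [simp]: "as_upoly x (mconst c) = [:mconst c:]"
  by (simp add: as_upoly_def mp_eval_mconst[OF ring_hom_fun_const_mconst])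

lemma as_upoly_var: "as_upoly x (var i) = (if i = x then [:0, 1:] else [:var i:])"
  by (simp add: as_upoly_def mp_eval_var[OF ring_hom_fun_const_mconst])

lemma total_upoly_mconst [simp]: "total_upoly (mconst c) = [:mconst c:]"
  by (simp add: total_upoly_def mp_eval_mconst[OF ring_hom_fun_const_mconst])

lemma total_upoly_var [simp]: "total_upoly (var i) = [:0, var i:]"
  by (simp add: total_upoly_def mp_eval_var[OF ring_hom_fun_const_mconst])

lemma poly_as_upoly: "poly (as_upoly x p) (var x) = p"
  by (rule mpoly_hom_eqI[OF ring_hom_fun_comp[OF ring_hom_fun_poly as_upoly.ring_hom_fun_axioms] ring_hom_fun_id])
     (auto simp: as_upoly_var)

lemma poly_total_upoly: "poly (total_upoly p) 1 = p"
  by (rule mpoly_hom_eqI[OF ring_hom_fun_comp[OF ring_hom_fun_poly total_upoly.ring_hom_fun_axioms] ring_hom_fun_id])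
     auto

lemma as_upoly_eq_0_iff [simp]: "as_upoly x p = 0 \<longleftrightarrow> p = 0"
  using poly_as_upoly[of x p] by (auto simp: as_upoly.hom_zero)

lemma total_upoly_eq_0_iff [simp]: "total_upoly p = 0 \<longleftrightarrow> p = 0"
  using poly_total_upoly[of p] by (auto simp: total_upoly.hom_zero)

lemma as_upoly_degree_0: "vdeg x p = 0 \<Longrightarrow> as_upoly x p = [:p:]"
  using poly_as_upoly[of x p] by (auto elim: degree_eq_zeroE)

lemma total_upoly_single:
  "total_upoly (Poly_Mapping.single m c) = monom (Poly_Mapping.single m c) (\<Sum>i\<in>Poly_Mapping.keys m. Poly_Mapping.lookup m i)"
proof -
  have "total_upoly (Poly_Mapping.single m c) = [:mconst c:] * (\<Prod>i\<in>Poly_Mapping.keys m. [:0, var i:] ^ Poly_Mapping.lookup m i)"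
    by (simp add: total_upoly_def mp_eval_single[OF ring_hom_fun_const_mconst] monom_eval_def)
  also have "[:0, var i:] = monom (var i :: ('a, 'b) mpoly) 1" for i :: 'a
    by (simp add: monom_altdef)
  then have "(\<Prod>i\<in>Poly_Mapping.keys m. [:0, var i:] ^ Poly_Mapping.lookup m i) =
     (\<Prod>i\<in>Poly_Mapping.keys m. monom (var i ^ Poly_Mapping.lookup m i :: ('a, 'b) mpoly) (Poly_Mapping.lookup m i))"
    by (simp add: monom_power)
  also have "\<dots> = monom (\<Prod>i\<in>A. var i ^ Poly_Mapping.lookup m i) (\<Sum>i\<in>A. Poly_Mapping.lookup m i)"
    if "A = Poly_Mapping.keys m" for A
  proof -
    have "finite A" using that by simp
    then have "(\<Prod>i\<in>A. monom (var i ^ Poly_Mapping.lookup m i :: ('a, 'b) mpoly) (Poly_Mapping.lookup m i)) = 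
       monom (\<Prod>i\<in>A. var i ^ Poly_Mapping.lookup m i) (\<Sum>i\<in>A. Poly_Mapping.lookup m i)"
      by (induction A rule: finite_induct) (simp_all add: mult_monom)
    then show ?thesis using that by simp
  qed
  finally show ?thesis
    by (simp add: monomial_eq_prod monom_eval_def smult_monom)
qed

lemma lookup_coeff_total_upoly:
  "Poly_Mapping.lookup (coeff (total_upoly p) k) m =
    (if (\<Sum>i\<in>Poly_Mapping.keys m. Poly_Mapping.lookup m i) = k then Poly_Mapping.lookup p m else 0)"
proof (induction p rule: poly_mapping_single_induct)
  case (single n c)
  then show ?case by (auto simp: total_upoly_single lookup_single when_def)
qed (simp_all add: total_upoly.hom_zero total_upoly.hom_add lookup_add)

lemma as_upoly_single:
  fixes c :: "'b::comm_ring_1"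
  shows "as_upoly x (Poly_Mapping.single m c) =
    monom (Poly_Mapping.single (m - Poly_Mapping.single x (Poly_Mapping.lookup m x)) c) (Poly_Mapping.lookup m x)"
proof -
  define k where "k = Poly_Mapping.lookup m x"
  define n where "n = m - Poly_Mapping.single x k"
  have m: "m = n + Poly_Mapping.single x k"
    by (rule poly_mapping_eqI) (auto simp: n_def k_def lookup_add lookup_minus lookup_single when_def)
  have nx: "Poly_Mapping.lookup n x = 0"
    by (simp add: n_def k_def lookup_minus)
  have "as_upoly x (Poly_Mapping.single m c) =
      [:mconst c:] * monom_eval (\<lambda>i. if i = x then [:0, 1:] else [:var i:]) m"
    by (simp add: as_upoly_def mp_eval_single[OF ring_hom_fun_const_mconst])
  also have "\<dots> = [:mconst c:] * monom_eval (\<lambda>i. if i = x then [:0, 1:] else [:var i:]) n * monom 1 k"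
    unfolding m by (simp add: monom_eval_add monom_altdef)
  also have "monom_eval (\<lambda>i. if i = x then [:0, 1:] else [:var i:]) n
      = (\<Prod>i\<in>Poly_Mapping.keys n. [:var i ^ Poly_Mapping.lookup n i :: ('a, 'b) mpoly:])"
    unfolding monom_eval_def using nx by (intro prod.cong) (auto simp: in_keys_iff poly_const_pow)
  also have "\<dots> = [:monom_eval var n:]"
    unfolding monom_eval_def
    by (rule ring_hom_fun.hom_prod[OF ring_hom_fun_const_poly, symmetric])
  finally show ?thesis
    by (simp add: monomial_eq_prod smult_monom flip: n_def k_def)
qed

lemma lookup_coeff_as_upoly:
  fixes p :: "('n, 'a::comm_ring_1) mpoly"
  shows "Poly_Mapping.lookup (coeff (as_upoly x p) k) m =
    (if Poly_Mapping.lookup m x = 0 then Poly_Mapping.lookup p (m + Poly_Mapping.single x k) else 0)"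
proof (induction p rule: poly_mapping_single_induct)
  case (single n c)
  have eq: "(Poly_Mapping.lookup n x = k \<and> n - Poly_Mapping.single x k = m) \<longleftrightarrow>
     Poly_Mapping.lookup m x = 0 \<and> n = m + Poly_Mapping.single x k"
  proof safe
    show "n = n - Poly_Mapping.single x (Poly_Mapping.lookup n x) + Poly_Mapping.single x (Poly_Mapping.lookup n x)"
      by (rule poly_mapping_eqI) (auto simp: lookup_add lookup_minus lookup_single when_def)
  qed (simp_all add: lookup_add lookup_minus)
  show ?case
    using eq by (auto simp: as_upoly_single lookup_single when_def)
qed (simp_all add: as_upoly.hom_zero as_upoly.hom_add lookup_add)

lemma vdeg_eq_0_iff: "vdeg x p = 0 \<longleftrightarrow> (\<forall>m\<in>Poly_Mapping.keys p. Poly_Mapping.lookup m x = 0)"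
proof
  assume "vdeg x p = 0"
  then have eq: "as_upoly x p = [:p:]" by (rule as_upoly_degree_0)
  have "Poly_Mapping.lookup p m = 0" if "Poly_Mapping.lookup m x \<noteq> 0" for m
    using lookup_coeff_as_upoly[of x p 0 m] that by (simp add: eq)
  then show "\<forall>m\<in>Poly_Mapping.keys p. Poly_Mapping.lookup m x = 0"
    by (auto simp: in_keys_iff)
next
  assume *: "\<forall>m\<in>Poly_Mapping.keys p. Poly_Mapping.lookup m x = 0"
  have "coeff (as_upoly x p) k = 0" if "k > 0" for k
  proof (rule poly_mapping_eqI)
    fix m
    show "Poly_Mapping.lookup (coeff (as_upoly x p) k) m = Poly_Mapping.lookup 0 m"
      using bspec[OF *, of "m + Poly_Mapping.single x k"] that
      by (auto simp: lookup_coeff_as_upoly in_keys_iff lookup_add)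
  qed
  then show "vdeg x p = 0"
    by (metis gr0I leading_coeff_0_iff degree_0)
qed

lemma vdeg_coeff_as_upoly_self: "vdeg x (coeff (as_upoly x p) k) = 0"
  by (auto simp: vdeg_eq_0_iff in_keys_iff lookup_coeff_as_upoly split: if_splits)

lemma vdeg_coeff_as_upoly:
  assumes "vdeg y p = 0"
  shows "vdeg y (coeff (as_upoly x p) k) = 0"
  unfolding vdeg_eq_0_iff
proof
  fix m assume "m \<in> Poly_Mapping.keys (coeff (as_upoly x p) k)"
  then have "m + Poly_Mapping.single x k \<in> Poly_Mapping.keys p"
    by (auto simp: in_keys_iff lookup_coeff_as_upoly split: if_splits)
  then show "Poly_Mapping.lookup m y = 0"
    using assms by (auto simp: vdeg_eq_0_iff lookup_add)
qed
 
lemma as_upoly_poly_var: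
  assumes "\<And>k. vdeg x (coeff P k) = 0"
  shows "as_upoly x (poly P (var x)) = P"
  using assms
proof (induction P)
  case 0
  then show ?case by (simp add: as_upoly.hom_zero)
next
  case (pCons a P)
  have "vdeg x (coeff P k) = 0" for k using pCons.prems[of "Suc k"] by simp
  then have "as_upoly x (poly P (var x)) = P" by (rule pCons.IH)
  moreover have "as_upoly x a = [:a:]" using pCons.prems[of 0] by (intro as_upoly_degree_0) simp
  ultimately show ?case by (simp add: as_upoly.hom_add as_upoly.hom_mult as_upoly_var)
qed

lemma tdeg_eq_0D: "tdeg p = 0 \<Longrightarrow> p = mconst (Poly_Mapping.lookup p 0)"
proof (rule poly_mapping_eqI)
  fix m assume "tdeg p = 0"
  then have eq: "total_upoly p = [:p:]" using poly_total_upoly[of p] by (auto elim: degree_eq_zeroE)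
  show "Poly_Mapping.lookup p m = Poly_Mapping.lookup (mconst (Poly_Mapping.lookup p 0)) m"
  proof (cases "m = 0")
    case False
    then obtain i where "Poly_Mapping.lookup m i \<noteq> 0" by (metis poly_mapping_eqI lookup_zero)
    then have "(\<Sum>i\<in>Poly_Mapping.keys m. Poly_Mapping.lookup m i) \<noteq> 0" by (auto simp: in_keys_iff)
    then have "Poly_Mapping.lookup p m = 0"
      using lookup_coeff_total_upoly[of p 0 m] by (simp only: eq coeff_pCons_0 if_False)
    then show ?thesis using False by (simp add: mconst_def lookup_single when_def)
  qed (simp add: mconst_def)
qed

section \<open>Unique factorization\<close>

lemma vdeg_mult:
  fixes p q :: "('n::linorder, 'a::idom) mpoly"
  assumes "p \<noteq> 0" "q \<noteq> 0"
  shows "vdeg x (p * q) = vdeg x p + vdeg x q"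
  using assms by (simp add: as_upoly.hom_mult degree_mult_eq)

lemma tdeg_mult:
  fixes p q :: "('n::linorder, 'a::idom) mpoly"
  assumes "p \<noteq> 0" "q \<noteq> 0"
  shows "tdeg (p * q) = tdeg p + tdeg q"
  using assms by (simp add: total_upoly.hom_mult degree_mult_eq)

lemma mpoly_unit_iff:
  fixes p :: "('n::linorder, 'a::field) mpoly"
  shows "p dvd 1 \<longleftrightarrow> p \<noteq> 0 \<and> tdeg p = 0"
proof
  assume "p dvd 1"
  then obtain q where q: "1 = p * q" by (auto simp: dvd_def)
  then have "p \<noteq> 0" "q \<noteq> 0" by auto
  then have "tdeg p + tdeg q = tdeg (p * q)" by (simp add: tdeg_mult)
  also have "\<dots> = 0" by (simp add: total_upoly.hom_one flip: q)
  finally have "tdeg p + tdeg q = 0" .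
  with \<open>p \<noteq> 0\<close> show "p \<noteq> 0 \<and> tdeg p = 0" by simp
next
  assume *: "p \<noteq> 0 \<and> tdeg p = 0"
  define c where "c = Poly_Mapping.lookup p 0"
  have p: "p = mconst c" using * tdeg_eq_0D c_def by blast
  with * have "c \<noteq> 0" by (auto simp: mconst_def)
  then have "p * mconst (inverse c) = 1"
    by (simp add: p mconst_def mult_single)
  then show "p dvd 1" by (metis dvdI)
qed

lemma mpoly_irreducible_factor:
  fixes p :: "('n::linorder, 'a::field) mpoly"
  assumes "p \<noteq> 0" "\<not> p dvd 1"
  obtains q where "irreducible q" "q dvd p"
proof -
  have "\<exists>q. irreducible q \<and> q dvd p"
    using assms
  proof (induction "tdeg p" arbitrary: p rule: less_induct)
    case less
    show ?case
    proof (cases "irreducible p")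
      case False
      then obtain a b where ab: "p = a * b" "\<not> a dvd 1" "\<not> b dvd 1"
        using less.prems by (auto simp: irreducible_def)
      then have "a \<noteq> 0" "b \<noteq> 0" using less.prems by auto
      then have "tdeg a < tdeg p" using ab mpoly_unit_iff[of b] by (simp add: tdeg_mult)
      then obtain q where "irreducible q" "q dvd a"
        using less.hyps \<open>a \<noteq> 0\<close> ab(2) by blast
      then show ?thesis using ab(1) by (auto intro: dvd_mult2)
    qed auto
  qed
  then show ?thesis using that by blast
qed

text \<open>The subring k[V], kept as a subset of the full ring so that an induction on the number
  of variables takes place inside one type.\<close>

definition polys_in :: "'n set \<Rightarrow> ('n, 'a::comm_ring_1) mpoly set" where
  "polys_in V = {p. \<forall>x. x \<notin> V \<longrightarrow> vdeg x p = 0}"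

lemma polys_in_iff: "p \<in> polys_in V \<longleftrightarrow> (\<forall>x. x \<notin> V \<longrightarrow> as_upoly x p = [:p:])"
  using as_upoly_degree_0[of _ p] degree_pCons_0[of p] by (auto simp: polys_in_def)

lemma polys_in_0 [simp]: "0 \<in> polys_in V"
  by (simp add: polys_in_def as_upoly.hom_zero)

lemma polys_in_1 [simp]: "1 \<in> polys_in V"
  by (simp add: polys_in_def as_upoly.hom_one)

lemma polys_in_mconst [simp]: "mconst c \<in> polys_in V"
  by (simp add: polys_in_def)

lemma polys_in_var [simp]: "x \<in> V \<Longrightarrow> var x \<in> polys_in V"
  by (auto simp: polys_in_def as_upoly_var)

lemma polys_in_add [simp]: "p \<in> polys_in V \<Longrightarrow> q \<in> polys_in V \<Longrightarrow> p + q \<in> polys_in V"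
  by (simp add: polys_in_iff as_upoly.hom_add)

lemma polys_in_diff [simp]: "p \<in> polys_in V \<Longrightarrow> q \<in> polys_in V \<Longrightarrow> p - q \<in> polys_in V"
  by (simp add: polys_in_iff as_upoly.hom_diff)

lemma polys_in_mult [simp]: "p \<in> polys_in V \<Longrightarrow> q \<in> polys_in V \<Longrightarrow> p * q \<in> polys_in V"
  by (simp add: polys_in_iff as_upoly.hom_mult)

lemma polys_in_power [simp]: "p \<in> polys_in V \<Longrightarrow> p ^ k \<in> polys_in V"
  by (induction k) auto

lemma polys_in_sum: "(\<And>i. i \<in> A \<Longrightarrow> g i \<in> polys_in V) \<Longrightarrow> sum g A \<in> polys_in V"
  by (induction A rule: infinite_finite_induct) auto

lemma polys_in_prod: "(\<And>i. i \<in> A \<Longrightarrow> g i \<in> polys_in V) \<Longrightarrow> prod g A \<in> polys_in V"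
  by (induction A rule: infinite_finite_induct) auto

lemma polys_in_empty:
  assumes "p \<in> polys_in {}"
  shows "p = mconst (Poly_Mapping.lookup p 0)"
proof (rule poly_mapping_eqI)
  fix m
  have "m = 0" if "Poly_Mapping.lookup p m \<noteq> 0"
    using that assms by (intro poly_mapping_eqI) (auto simp: polys_in_def vdeg_eq_0_iff in_keys_iff)
  then show "Poly_Mapping.lookup p m = Poly_Mapping.lookup (mconst (Poly_Mapping.lookup p 0)) m"
    by (auto simp: mconst_def lookup_single when_def)
qed

lemma polys_in_mono: "V \<subseteq> W \<Longrightarrow> polys_in V \<subseteq> polys_in W"
  by (auto simp: polys_in_def)

lemma polys_in_insertI [simp]: "p \<in> polys_in V \<Longrightarrow> p \<in> polys_in (insert x V)"
  by (auto simp: polys_in_def)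

lemma polys_in_coeff:
  assumes "p \<in> polys_in (insert x V)"
  shows "coeff (as_upoly x p) k \<in> polys_in V"
  unfolding polys_in_def
proof (intro CollectI allI impI)
  fix y assume "y \<notin> V"
  then show "vdeg y (coeff (as_upoly x p) k) = 0"
    using assms vdeg_coeff_as_upoly[of y p x k] vdeg_coeff_as_upoly_self[of x p k]
    by (cases "y = x") (auto simp: polys_in_def)
qed

lemma polys_in_insert_vdeg_0: "p \<in> polys_in (insert x V) \<Longrightarrow> vdeg x p = 0 \<Longrightarrow> p \<in> polys_in V"
  by (simp add: polys_in_def) metis

lemma polys_in_factor:
  fixes p q :: "('n::linorder, 'a::idom) mpoly"
  assumes "p * q \<in> polys_in V" "p * q \<noteq> 0"
  shows "p \<in> polys_in V" "q \<in> polys_in V"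
  using assms vdeg_mult[of p q] by (auto simp: polys_in_def)

lemma vdeg_unit:
  fixes p :: "('n::linorder, 'a::idom) mpoly"
  assumes "p dvd 1"
  shows "vdeg x p = 0"
proof -
  obtain q where q: "1 = p * q" using assms by (auto simp: dvd_def)
  have "p * q \<in> polys_in {}" "p * q \<noteq> 0" by (simp_all flip: q)
  then have "p \<in> polys_in {}" by (rule polys_in_factor)
  then show ?thesis by (simp add: polys_in_def)
qed

lemma polys_in_finite_support:
  obtains V where "finite V" "p \<in> polys_in V"
proof
  let ?V = "\<Union>m\<in>Poly_Mapping.keys p. Poly_Mapping.keys m"
  show "finite ?V" by simp
  show "p \<in> polys_in ?V" by (auto simp: polys_in_def vdeg_eq_0_iff in_keys_iff)
qed

text \<open>Primality inside k[V], the property carried through the induction on V. Testing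
  divisibility in the full ring changes nothing for nonzero members of k[V], because
  \<open>polys_in_factor\<close> puts the quotient back into k[V].\<close>

definition prime_on :: "'n set \<Rightarrow> ('n, 'a::comm_ring_1) mpoly \<Rightarrow> bool" where
  "prime_on V p \<longleftrightarrow> (\<forall>a\<in>polys_in V. \<forall>b\<in>polys_in V. p dvd a * b \<longrightarrow> p dvd a \<or> p dvd b)"

lemma const_dvd_as_upoly_iff:
  fixes c p :: "('n::linorder, 'a::idom) mpoly"
  assumes "vdeg x c = 0"
  shows "c dvd p \<longleftrightarrow> (\<forall>k. c dvd coeff (as_upoly x p) k)"
proof
  assume "c dvd p"
  then have "as_upoly x c dvd as_upoly x p" by (rule as_upoly.hom_dvd)
  then show "\<forall>k. c dvd coeff (as_upoly x p) k"
    using assms by (simp add: as_upoly_degree_0 const_poly_dvd_iff)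
next
  assume "\<forall>k. c dvd coeff (as_upoly x p) k"
  then have "[:c:] dvd as_upoly x p" by (simp add: const_poly_dvd_iff)
  then have "poly [:c:] (var x) dvd poly (as_upoly x p) (var x)"
    by (rule ring_hom_fun.hom_dvd[OF ring_hom_fun_poly])
  then show "c dvd p" by (simp add: poly_as_upoly)
qed

text \<open>The argument of Gauss's lemma. If p divides neither a nor b, take the lowest
  coefficients of x^i in a and of x^j in b that p does not divide; in the coefficient of x^(i+j) in
  a b every other summand is divisible by p.\<close>

lemma prime_on_insert:
  fixes p :: "('n::linorder, 'a::idom) mpoly"
  assumes p: "p \<in> polys_in V" "prime_on V p" and x: "x \<notin> V"
  shows "prime_on (insert x V) p"
  unfolding prime_on_def
proof (intro ballI impI)
  fix a b assume a: "a \<in> polys_in (insert x V)" and b: "b \<in> polys_in (insert x V)"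
    and dvd: "p dvd a * b"
  have vp: "vdeg x p = 0" using p x by (auto simp: polys_in_def)
  let ?A = "coeff (as_upoly x a)" and ?B = "coeff (as_upoly x b)"
  show "p dvd a \<or> p dvd b"
  proof (rule ccontr)
    assume "\<not> (p dvd a \<or> p dvd b)"
    then have exA: "\<exists>i. \<not> p dvd ?A i" and exB: "\<exists>i. \<not> p dvd ?B i"
      using const_dvd_as_upoly_iff[OF vp] by blast+
    define i where "i = (LEAST i. \<not> p dvd ?A i)"
    define j where "j = (LEAST i. \<not> p dvd ?B i)"
    have i: "\<not> p dvd ?A i" "\<And>k. k < i \<Longrightarrow> p dvd ?A k"
      unfolding i_def using LeastI_ex[OF exA] not_less_Least by blast+
    have j: "\<not> p dvd ?B j" "\<And>k. k < j \<Longrightarrow> p dvd ?B k"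
      unfolding j_def using LeastI_ex[OF exB] not_less_Least by blast+
    have "p dvd coeff (as_upoly x (a * b)) (i + j)"
      using dvd const_dvd_as_upoly_iff[OF vp] by blast
    also have "coeff (as_upoly x (a * b)) (i + j) =
        ?A i * ?B j + (\<Sum>k\<in>{..i + j} - {i}. ?A k * ?B (i + j - k))"
      by (simp add: as_upoly.hom_mult coeff_mult sum.remove[of _ i])
    finally have "p dvd ?A i * ?B j + (\<Sum>k\<in>{..i + j} - {i}. ?A k * ?B (i + j - k))" .
    moreover have "p dvd (\<Sum>k\<in>{..i + j} - {i}. ?A k * ?B (i + j - k))"
    proof (rule dvd_sum)
      fix k assume "k \<in> {..i + j} - {i}"
      then have "k < i \<or> i + j - k < j" by auto
      then show "p dvd ?A k * ?B (i + j - k)" using i(2) j(2) by (auto intro: dvd_mult dvd_mult2)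
    qed
    ultimately have "p dvd ?A i * ?B j" by (simp add: dvd_add_left_iff)
    then show False
      using p(2) i(1) j(1) polys_in_coeff[OF a] polys_in_coeff[OF b] by (auto simp: prime_on_def)
  qed
qed

text \<open>The leading coefficient of h in x cannot be inverted, so each reduction step first
  multiplies by it. The factor c is the resulting power, which is free of x.\<close>

lemma mpoly_pseudo_division:
  fixes a h :: "('n::linorder, 'a::idom) mpoly"
  assumes h: "h \<in> polys_in (insert x V)" "h \<noteq> 0" and a: "a \<in> polys_in (insert x V)"
  obtains c q r where "c \<in> polys_in V" "c \<noteq> 0" "q \<in> polys_in (insert x V)"
    "r \<in> polys_in (insert x V)" "c * a = q * h + r" "r = 0 \<or> vdeg x r < vdeg x h"
proof -
  have "\<exists>c q r. c \<in> polys_in V \<and> c \<noteq> 0 \<and> q \<in> polys_in (insert x V) \<and>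
    r \<in> polys_in (insert x V) \<and> c * a = q * h + r \<and> (r = 0 \<or> vdeg x r < vdeg x h)"
    using a
  proof (induction "vdeg x a" arbitrary: a rule: less_induct)
    case less
    show ?case
    proof (cases "a = 0 \<or> vdeg x a < vdeg x h")
      case True
      then show ?thesis
        using less.prems by (intro exI[of _ 1] exI[of _ 0] exI[of _ a]) auto
    next
      case False
      then have a0: "a \<noteq> 0" and deg: "vdeg x h \<le> vdeg x a" by auto
      define l where "l = lead_coeff (as_upoly x h)"
      define m where "m = lead_coeff (as_upoly x a)"
      define k where "k = vdeg x a - vdeg x h"
      define s where "s = m * var x ^ k"
      define b where "b = l * a - s * h"
      have lm: "l \<in> polys_in V" "m \<in> polys_in V"
        unfolding l_def m_def using h(1) less.prems by (simp_all add: polys_in_coeff)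
      have l0: "l \<noteq> 0" using h(2) by (simp add: l_def)
      have s: "s \<in> polys_in (insert x V)" using lm by (simp add: s_def)
      have b: "b \<in> polys_in (insert x V)" using lm s h(1) less.prems by (simp add: b_def)
      have "vdeg x l = 0" "vdeg x m = 0"
        by (simp_all add: l_def m_def vdeg_coeff_as_upoly_self)
      then have b_up: "as_upoly x b = smult l (as_upoly x a) - monom m k * as_upoly x h"
        by (simp add: b_def s_def as_upoly.hom_diff as_upoly.hom_mult as_upoly.hom_power
            as_upoly_var as_upoly_degree_0 monom_altdef)
      have le: "vdeg x b \<le> vdeg x a"
        unfolding b_up
      proof (intro degree_diff_le)
        show "degree (smult l (as_upoly x a)) \<le> vdeg x a" by simp
        have "degree (monom m k * as_upoly x h) \<le> k + vdeg x h"
          by (rule order_trans[OF degree_mult_le]) (simp add: degree_monom_le)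
        then show "degree (monom m k * as_upoly x h) \<le> vdeg x a" using deg by (simp add: k_def)
      qed
      have "coeff (as_upoly x b) (vdeg x a) = 0"
        using deg by (simp add: b_up coeff_monom_mult l_def m_def k_def)
      then have "b = 0 \<or> vdeg x b < vdeg x a"
        using le leading_coeff_0_iff[of "as_upoly x b"] by (cases "vdeg x b = vdeg x a") auto
      then obtain c q r where cqr: "c \<in> polys_in V" "c \<noteq> 0" "q \<in> polys_in (insert x V)"
        "r \<in> polys_in (insert x V)" "c * b = q * h + r" "r = 0 \<or> vdeg x r < vdeg x h"
      proof
        assume "b = 0"
        then show ?thesis using that[of 1 0 0] by simp
      next
        assume "vdeg x b < vdeg x a"
        then show ?thesis using less.hyps[OF _ b] that by blast
      qed
      have "(c * l) * a = (q + c * s) * h + r"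
        using cqr(5) by (simp add: b_def algebra_simps)
      then show ?thesis
        using cqr lm s l0
        by (intro exI[of _ "c * l"] exI[of _ "q + c * s"] exI[of _ r]) auto
    qed
  qed
  then show ?thesis using that by blast
qed

section \<open>The induction step from k[V] to k[V][x]\<close>

context
  fixes V :: "'n::linorder set" and x :: 'n
  assumes x: "x \<notin> V"
    and prime_V: "\<And>p :: ('n, 'a::field) mpoly. p \<in> polys_in V \<Longrightarrow> irreducible p \<Longrightarrow> prime_on V p"
begin

text \<open>Irreducible factors of c can be peeled off one at a time: each is prime in k[V], hence
  in k[V][x] by \<open>prime_on_insert\<close>, and so divides a or b. This does the work of
  contents and gcds in the usual proof of Gauss's theorem.\<close>

lemma coeff_primal:
  fixes a b c w :: "('n, 'a) mpoly"
  assumes "c \<in> polys_in V" "c \<noteq> 0" and a: "a \<in> polys_in (insert x V)"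
    and b: "b \<in> polys_in (insert x V)" and eq: "c * w = a * b"
  shows "\<exists>c1\<in>polys_in V. \<exists>c2\<in>polys_in V. c = c1 * c2 \<and> c1 dvd a \<and> c2 dvd b"
  using assms
proof (induction "tdeg c" arbitrary: a b c rule: less_induct)
  case less
  note c = less.prems(1,2) and a = less.prems(3) and b = less.prems(4) and eq = less.prems(5)
  consider "c dvd 1" | "a = 0" | "b = 0" | "\<not> c dvd 1" "a \<noteq> 0" "b \<noteq> 0" by blast
  then show ?case
  proof cases
    case 1
    then have "c dvd a" by (rule dvd_trans) simp
    then show ?thesis using c by (intro bexI[of _ c] bexI[of _ 1]) auto
  next
    case 2
    then show ?thesis using c by (intro bexI[of _ c] bexI[of _ 1]) auto
  next
    case 3
    then show ?thesis using c by (intro bexI[of _ 1] bexI[of _ c]) auto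
  next
    case 4
    obtain p where p: "irreducible p" "p dvd c"
      using mpoly_irreducible_factor[OF c(2) 4(1)] by blast
    then obtain c' where c': "c = p * c'" by (auto simp: dvd_def)
    have V: "p \<in> polys_in V" "c' \<in> polys_in V" using c c' polys_in_factor by blast+
    have nz: "p \<noteq> 0" "c' \<noteq> 0" using c c' by auto
    have "tdeg p > 0" using p(1) mpoly_unit_iff[of p] by (auto simp: irreducible_def)
    then have less': "tdeg c' < tdeg c" using nz by (simp add: c' tdeg_mult)
    have "prime_on (insert x V) p" using prime_on_insert[OF V(1) prime_V[OF V(1) p(1)] x] .
    moreover have "p dvd a * b" using eq c' by (auto simp: mult.assoc simp flip: eq)
    ultimately have "p dvd a \<or> p dvd b" using a b by (auto simp: prime_on_def)
    then show ?thesis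
    proof
      assume "p dvd a"
      then obtain a' where a': "a = p * a'" by (auto simp: dvd_def)
      have "a' \<in> polys_in (insert x V)" using a a' 4 polys_in_factor by blast
      moreover have "c' * w = a' * b" using eq nz by (simp add: c' a' mult.assoc)
      ultimately obtain c1 c2 where "c1 \<in> polys_in V" "c2 \<in> polys_in V" "c' = c1 * c2"
        "c1 dvd a'" "c2 dvd b"
        using less.hyps[OF less' V(2) nz(2) _ b] by blast
      then show ?thesis
        using V by (intro bexI[of _ "p * c1"] bexI[of _ c2]) (auto simp: c' a' mult_dvd_mono mult.assoc)
    next
      assume "p dvd b"
      then obtain b' where b': "b = p * b'" by (auto simp: dvd_def)
      have "b' \<in> polys_in (insert x V)" using b b' 4 polys_in_factor by blast
      moreover have "p * (c' * w) = p * (a * b')" using eq by (simp add: c' b' mult_ac)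
      then have "c' * w = a * b'" using nz by simp
      ultimately obtain c1 c2 where "c1 \<in> polys_in V" "c2 \<in> polys_in V" "c' = c1 * c2"
        "c1 dvd a" "c2 dvd b'"
        using less.hyps[OF less' V(2) nz(2) a] by blast
      then show ?thesis
        using V by (intro bexI[of _ c1] bexI[of _ "p * c2"]) (auto simp: c' b' mult_dvd_mono mult_ac)
    qed
  qed
qed

text \<open>If c a = p w, then c splits as c1 c2 with c1 dividing p and c2 dividing w. The cofactor
  of c1 in p still involves x and is no unit, so irreducibility of p makes c1 a unit.\<close>

lemma irreducible_dvd_cancel_coeff:
  fixes a c p :: "('n, 'a) mpoly"
  assumes p: "irreducible p" "p \<in> polys_in (insert x V)" "vdeg x p > 0"
    and c: "c \<in> polys_in V" "c \<noteq> 0" and a: "a \<in> polys_in (insert x V)" and dvd: "p dvd c * a"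
  shows "p dvd a"
proof (cases "a = 0")
  case False
  obtain w where w: "c * a = p * w" using dvd by (auto simp: dvd_def)
  have "p * w \<noteq> 0" "p * w \<in> polys_in (insert x V)" unfolding w[symmetric] using False c a by auto
  then have "w \<in> polys_in (insert x V)" using polys_in_factor by blast
  then obtain c1 c2 where c12: "c1 \<in> polys_in V" "c2 \<in> polys_in V" "c = c1 * c2" "c1 dvd p" "c2 dvd w"
    using coeff_primal[OF c p(2) _ w] by blast
  obtain e where e: "p = c1 * e" using c12 by (auto simp: dvd_def)
  obtain w' where w': "w = c2 * w'" using c12 by (auto simp: dvd_def)
  have "p \<noteq> 0" using p(1) by auto
  then have nz: "c1 \<noteq> 0" "e \<noteq> 0" "c2 \<noteq> 0" using e c c12 by auto
  have "vdeg x c1 = 0" using c12(1) x by (auto simp: polys_in_def)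
  then have "vdeg x e > 0" using p(3) nz by (simp add: e vdeg_mult)
  then have "\<not> e dvd 1" using vdeg_unit[of e x] by auto
  then have "c1 dvd 1" using p(1) e by (auto simp: irreducible_def)
  then obtain i where i: "1 = c1 * i" by (auto simp: dvd_def)
  have "c2 * (c1 * a) = c2 * (p * w')" using w by (simp add: c12(3) w' mult_ac)
  then have "c1 * a = p * w'" using nz by simp
  then have "a * (c1 * i) = p * (w' * i)" by (simp add: mult_ac)
  then have "a = p * (w' * i)" by (simp flip: i)
  then show ?thesis by (rule dvdI)
qed auto

text \<open>Bezout's identity over the fraction field of k[V], with denominators cleared. An element
  h of least x-degree in the ideal (p, a) divides p and a up to factors from k[V]. Either p divides
  h, and then p divides a; or h lies in k[V], and then p divides h b = s p b + t a b, hence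
  b.\<close>

lemma irreducible_prime_on_insert:
  fixes p :: "('n, 'a) mpoly"
  assumes p: "irreducible p" "p \<in> polys_in (insert x V)"
  shows "prime_on (insert x V) p"
proof (cases "vdeg x p = 0")
  case True
  then have "p \<in> polys_in V" using p(2) by (rule polys_in_insert_vdeg_0[rotated])
  then show ?thesis using prime_on_insert[OF _ prime_V[OF _ p(1)] x] by blast
next
  case False
  let ?S = "polys_in (insert x V) :: ('n, 'a) mpoly set"
  show ?thesis
    unfolding prime_on_def
  proof (intro ballI impI)
    fix a b assume a: "a \<in> ?S" and b: "b \<in> ?S" and dvd: "p dvd a * b"
    show "p dvd a \<or> p dvd b"
    proof (rule ccontr)
      assume "\<not> (p dvd a \<or> p dvd b)"
      then have na: "\<not> p dvd a" and nb: "\<not> p dvd b" by auto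
      define I where "I = {s * p + t * a | s t. s \<in> ?S \<and> t \<in> ?S}"
      have I_S: "I \<subseteq> ?S" using p(2) a by (auto simp: I_def)
      have pI: "p \<in> I" unfolding I_def by (rule CollectI, rule exI[of _ 1], rule exI[of _ 0]) simp
      have aI: "a \<in> I" unfolding I_def by (rule CollectI, rule exI[of _ 0], rule exI[of _ 1]) simp
      have I_comb: "c * u - q * v \<in> I" if uv: "u \<in> I" "v \<in> I" and cq: "c \<in> ?S" "q \<in> ?S" for c u q v
      proof -
        obtain s t s' t' where "u = s * p + t * a" "v = s' * p + t' * a"
          and st: "s \<in> ?S" "t \<in> ?S" "s' \<in> ?S" "t' \<in> ?S"
          using uv unfolding I_def by blast
        then have "c * u - q * v = (c * s - q * s') * p + (c * t - q * t') * a"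
          by (simp add: algebra_simps)
        moreover have "c * s - q * s' \<in> ?S" "c * t - q * t' \<in> ?S" using st cq by simp_all
        ultimately show ?thesis unfolding I_def by blast
      qed
      have "p \<noteq> 0" using p(1) by auto
      then have "\<exists>h. h \<in> I \<and> h \<noteq> 0" using pI by auto
      then obtain h where h: "h \<in> I" "h \<noteq> 0" and
        min: "\<And>g. g \<in> I \<Longrightarrow> g \<noteq> 0 \<Longrightarrow> vdeg x h \<le> vdeg x g"
        using ex_has_least_nat[of "\<lambda>h. h \<in> I \<and> h \<noteq> 0" _ "vdeg x"] by blast
      have hS: "h \<in> ?S" using h I_S by auto
      have div: "\<exists>c q. c \<in> polys_in V \<and> c \<noteq> 0 \<and> q \<in> ?S \<and> c * g = q * h" if g: "g \<in> I" for g
      proof -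
        obtain c q r where cqr: "c \<in> polys_in V" "c \<noteq> 0" "q \<in> ?S" "r \<in> ?S"
          "c * g = q * h + r" "r = 0 \<or> vdeg x r < vdeg x h"
          using mpoly_pseudo_division[OF hS h(2), of g] g I_S by blast
        have "r = c * g - q * h" using cqr(5) by simp
        then have "r \<in> I" using I_comb[OF g h(1), of c q] cqr by simp
        then have "r = 0" using cqr(6) min by force
        then show ?thesis using cqr by auto
      qed
      obtain c q where cq: "c \<in> polys_in V" "c \<noteq> 0" "q \<in> ?S" "c * p = q * h"
        using div[OF pI] by blast
      then obtain c1 c2 where c12: "c1 \<in> polys_in V" "c2 \<in> polys_in V" "c = c1 * c2" "c1 dvd q" "c2 dvd h"
        using coeff_primal[OF cq(1,2,3) hS cq(4)] by blast
      obtain q' h' where q': "q = c1 * q'" and h': "h = c2 * h'" using c12 by (auto simp: dvd_def)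
      have "c * p = c * (q' * h')" using cq(4) by (simp add: c12(3) q' h' mult_ac)
      then have ph: "p = q' * h'" using cq by simp
      have "q' dvd 1 \<or> h' dvd 1" using p(1) ph by (auto simp: irreducible_def)
      then show False
      proof
        assume "q' dvd 1"
        then obtain i where "1 = q' * i" by (auto simp: dvd_def)
        moreover have "h' * (q' * i) = p * i" using ph by (simp add: mult_ac)
        ultimately have "h' = p * i" by simp
        then have "p dvd h" using h' by auto
        moreover obtain d u where du: "d \<in> polys_in V" "d \<noteq> 0" "d * a = u * h"
          using div[OF aI] by blast
        ultimately have "p dvd d * a" by auto
        then show False using irreducible_dvd_cancel_coeff[OF p _ du(1,2) a] False na by auto
      next
        assume "h' dvd 1"
        moreover have "c2 \<noteq> 0" "h' \<noteq> 0" using h h' by auto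
        moreover have "vdeg x c2 = 0" using c12(2) x by (auto simp: polys_in_def)
        moreover have "vdeg x h' = 0"
          using \<open>h' dvd 1\<close> by (rule vdeg_unit)
        ultimately have "vdeg x h = 0" by (simp add: h' vdeg_mult)
        then have hV: "h \<in> polys_in V" using polys_in_insert_vdeg_0[OF hS] by blast
        obtain s t where "h = s * p + t * a" using h(1) by (auto simp: I_def)
        then have "h * b = p * (s * b) + t * (a * b)" by (simp add: algebra_simps)
        then have "p dvd h * b" using dvd by simp
        then show False using irreducible_dvd_cancel_coeff[OF p _ hV h(2) b] False nb by auto
      qed
    qed
  qed
qed

end

lemma irreducible_prime_on_finite:
  fixes p :: "('n::linorder, 'a::field) mpoly"
  assumes "finite V" "p \<in> polys_in V" "irreducible p"
  shows "prime_on V p"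
  using assms
proof (induction V arbitrary: p rule: finite_induct)
  case empty
  have "p = mconst (Poly_Mapping.lookup p 0)" using empty.prems(1) by (rule polys_in_empty)
  then have "tdeg p = tdeg (mconst (Poly_Mapping.lookup p 0) :: ('n, 'a) mpoly)" by simp
  then have "tdeg p = 0" by (simp only: total_upoly_mconst degree_pCons_0)
  then show ?case using empty.prems(2) mpoly_unit_iff[of p] by (auto simp: irreducible_def)
next
  case (insert x V)
  then show ?case using irreducible_prime_on_insert[of x V p] by blast
qed

lemma mpoly_irreducible_imp_prime_elem:
  fixes p :: "('n::linorder, 'a::field) mpoly"
  assumes "irreducible p"
  shows "prime_elem p"
proof (rule prime_elemI)
  show "p \<noteq> 0" "\<not> p dvd 1" using assms by (auto simp: irreducible_def)
  fix a b assume dvd: "p dvd a * b"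
  obtain A where "finite A" "a \<in> polys_in A" by (rule polys_in_finite_support)
  moreover obtain B where "finite B" "b \<in> polys_in B" by (rule polys_in_finite_support)
  moreover obtain P where "finite P" "p \<in> polys_in P" by (rule polys_in_finite_support)
  ultimately have *: "finite A" "finite B" "finite P" "a \<in> polys_in A" "b \<in> polys_in B" "p \<in> polys_in P"
    by auto
  then have "a \<in> polys_in (A \<union> B \<union> P)" "b \<in> polys_in (A \<union> B \<union> P)" "p \<in> polys_in (A \<union> B \<union> P)"
    by (auto simp: polys_in_def)
  moreover from this have "prime_on (A \<union> B \<union> P) p"
    using * assms by (intro irreducible_prime_on_finite) auto
  ultimately show "p dvd a \<or> p dvd b" using dvd by (auto simp: prime_on_def)
qed

section \<open>Separability along a generic line\<close>

lemma pderiv_map_poly: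
  fixes h :: "'r::idom \<Rightarrow> 's::idom"
  assumes "ring_hom_fun h"
  shows "pderiv (map_poly h P) = map_poly h (pderiv P)"
proof -
  interpret ring_hom_fun h by fact
  show ?thesis
    by (intro poly_eqI) (simp add: coeff_pderiv coeff_map_poly hom_zero hom_mult hom_of_nat del: of_nat_Suc)
qed

lemma (in ring_hom_fun) hom_mp_eval: "h (mp_eval \<phi> v p) = mp_eval (\<lambda>c. h (\<phi> c)) (\<lambda>i. h (v i)) p"
  by (simp add: mp_eval_def monom_eval_def hom_sum hom_mult hom_prod hom_power)

lemma mp_eval_mconst_var: "mp_eval mconst var p = p"
  by (rule mpoly_hom_eqI[OF ring_hom_fun_mp_eval[OF ring_hom_fun_mconst] ring_hom_fun_id])
     (simp_all add: mp_eval_mconst[OF ring_hom_fun_mconst] mp_eval_var[OF ring_hom_fun_mconst])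

lemma mp_eval_cong_polys_in:
  assumes "p \<in> polys_in V" "\<And>i. i \<in> V \<Longrightarrow> v i = w i"
  shows "mp_eval \<phi> v p = mp_eval \<phi> w p"
  unfolding mp_eval_def monom_eval_def
proof (intro sum.cong refl arg_cong[where f = "\<lambda>x. _ * x"] prod.cong)
  fix m i assume m: "m \<in> Poly_Mapping.keys p" and i: "i \<in> Poly_Mapping.keys m"
  then have "i \<in> V" using assms(1) by (auto simp: polys_in_def vdeg_eq_0_iff in_keys_iff)
  then show "v i ^ Poly_Mapping.lookup m i = w i ^ Poly_Mapping.lookup m i" by (simp add: assms(2))
qed

lemma of_nat_mpoly: "(of_nat n :: ('n, 'a::comm_ring_1) mpoly) = mconst (of_nat n)"
  by (simp add: mconst_def)

lemma CHAR_mpoly: "CHAR(('n, 'a::comm_ring_1) mpoly) = CHAR('a)"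
proof (rule CHAR_eqI)
  show "of_nat CHAR('a) = (0 :: ('n, 'a) mpoly)" by (simp add: of_nat_mpoly mconst_def del: single_of_nat)
  fix n assume "of_nat n = (0 :: ('n, 'a) mpoly)"
  then have "Poly_Mapping.lookup (of_nat n :: ('n, 'a) mpoly) 0 = 0" by simp
  then show "CHAR('a) dvd n" by (simp add: lookup_of_nat of_nat_eq_0_iff_char_dvd)
qed

section \<open>Partial derivatives and inseparability\<close>

definition pdiff :: "'n::linorder \<Rightarrow> ('n, 'a::idom) mpoly \<Rightarrow> ('n, 'a) mpoly" where
  "pdiff x p = poly (pderiv (as_upoly x p)) (var x)"

lemma pdiff_mult:
  fixes p q :: "('n::linorder, 'a::idom) mpoly"
  shows "pdiff x (p * q) = p * pdiff x q + q * pdiff x p"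
  by (simp add: pdiff_def as_upoly.hom_mult pderiv_mult poly_as_upoly)

lemma as_upoly_pdiff:
  fixes p :: "('n::linorder, 'a::idom) mpoly"
  shows "as_upoly x (pdiff x p) = pderiv (as_upoly x p)"
  unfolding pdiff_def
proof (rule as_upoly_poly_var)
  fix k
  show "vdeg x (coeff (pderiv (as_upoly x p)) k) = 0"
    using vdeg_coeff_as_upoly_self[of x p "Suc k", THEN as_upoly_degree_0]
    by (simp add: coeff_pderiv as_upoly.hom_mult as_upoly.hom_of_nat of_nat_poly del: of_nat_Suc)
qed

lemma single_power:
  fixes m :: "'n \<Rightarrow>\<^sub>0 nat" and c :: "'a::comm_ring_1"
  shows "Poly_Mapping.single m c ^ k = Poly_Mapping.single (Poly_Mapping.map ((*) k) m) (c ^ k)"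
proof (induction k)
  case 0
  have "Poly_Mapping.map ((*) 0) m = 0" by (rule poly_mapping_eqI) (simp add: Poly_Mapping.map.rep_eq)
  then show ?case by (simp only: power_0 single_one)
next
  case (Suc k)
  have "m + Poly_Mapping.map ((*) k) m = Poly_Mapping.map ((*) (Suc k)) m"
    by (rule poly_mapping_eqI) (simp add: Poly_Mapping.map.rep_eq lookup_add when_def)
  then show ?case by (simp only: power_Suc Suc mult_single)
qed

text \<open>Vanishing partial derivatives make all exponents divisible by p, and the coefficients
  have p-th roots in an algebraically closed field. Additivity of Frobenius then lets the root be
  taken term by term.\<close>

lemma mpoly_pth_power:
  fixes g :: "('n::linorder, 'a::alg_closed_field) mpoly"
  assumes p: "CHAR('a) = p" "p > 0" and pd: "\<And>x. pdiff x g = 0"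
  obtains h where "g = h ^ p"
proof -
  have prime: "prime p" using p prime_CHAR_semidom by metis
  have dvd: "p dvd Poly_Mapping.lookup m x" if m: "m \<in> Poly_Mapping.keys g" for m x
  proof (rule ccontr)
    assume nd: "\<not> p dvd Poly_Mapping.lookup m x"
    then obtain k where k: "Poly_Mapping.lookup m x = Suc k" by (cases "Poly_Mapping.lookup m x") auto
    have "pderiv (as_upoly x g) = 0"
      unfolding as_upoly_pdiff[symmetric] by (simp add: pd as_upoly.hom_zero)
    then have "of_nat (Suc k) * coeff (as_upoly x g) (Suc k) = 0"
      by (metis coeff_pderiv coeff_0)
    moreover have "(of_nat (Suc k) :: ('n, 'a) mpoly) \<noteq> 0"
      using nd k by (simp only: of_nat_eq_0_iff_char_dvd CHAR_mpoly p not_False_eq_True)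
    ultimately have "coeff (as_upoly x g) (Suc k) = 0" using mult_eq_0_iff by blast
    then have "Poly_Mapping.lookup g (m - Poly_Mapping.single x (Suc k) + Poly_Mapping.single x (Suc k)) = 0"
      using lookup_coeff_as_upoly[of x g "Suc k" "m - Poly_Mapping.single x (Suc k)"] k
      by (simp add: lookup_minus)
    moreover have "m - Poly_Mapping.single x (Suc k) + Poly_Mapping.single x (Suc k) = m"
      using k by (intro poly_mapping_eqI) (auto simp: lookup_add lookup_minus lookup_single when_def)
    ultimately show False using m by (simp add: in_keys_iff)
  qed
  define rt where "rt c = (SOME y. y ^ p = c)" for c :: 'a
  have rt: "rt c ^ p = c" for c
    unfolding rt_def using nth_root_exists[OF p(2)] by (rule someI_ex)
  define h where "h = (\<Sum>m\<in>Poly_Mapping.keys g.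
    Poly_Mapping.single (Poly_Mapping.map (\<lambda>k. k div p) m) (rt (Poly_Mapping.lookup g m)))"
  have "h ^ p = (\<Sum>m\<in>Poly_Mapping.keys g.
    Poly_Mapping.single (Poly_Mapping.map (\<lambda>k. k div p) m) (rt (Poly_Mapping.lookup g m)) ^ p)"
    unfolding h_def using prime p by (intro freshmans_dream_sum) (simp_all add: CHAR_mpoly)
  also have "\<dots> = (\<Sum>m\<in>Poly_Mapping.keys g. Poly_Mapping.single m (Poly_Mapping.lookup g m))"
  proof (rule sum.cong)
    fix m assume m: "m \<in> Poly_Mapping.keys g"
    have "Poly_Mapping.map ((*) p) (Poly_Mapping.map (\<lambda>k. k div p) m) = m"
      using dvd[OF m] by (intro poly_mapping_eqI) (simp add: Poly_Mapping.map.rep_eq when_def dvd_div_eq_0_iff)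
    then show "Poly_Mapping.single (Poly_Mapping.map (\<lambda>k. k div p) m) (rt (Poly_Mapping.lookup g m)) ^ p
        = Poly_Mapping.single m (Poly_Mapping.lookup g m)" by (simp add: single_power rt)
  qed simp
  finally show ?thesis using that poly_mapping_sum_single[of g] by metis
qed

lemma irreducible_pdiff_nonzero:
  fixes g :: "('n::linorder, 'a::alg_closed_field) mpoly"
  assumes "CHAR('a) > 0" and irr: "irreducible g"
  shows "\<exists>x. pdiff x g \<noteq> 0"
proof (rule ccontr)
  assume "\<nexists>x. pdiff x g \<noteq> 0"
  then obtain h where h: "g = h ^ CHAR('a)" using mpoly_pth_power[of "CHAR('a)" g] assms by auto
  have "CHAR('a) \<noteq> 1" using CHAR_not_1' by auto
  then obtain k where k: "CHAR('a) = Suc (Suc k)"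
    using assms(1) by (metis One_nat_def not0_implies_Suc not_gr_zero)
  then have "g = h * h ^ Suc k" using h by simp
  then have "h dvd 1 \<or> h ^ Suc k dvd 1" using irr unfolding irreducible_def by blast
  then have "h dvd 1" by (auto dest: dvd_mult_left)
  then have "g dvd 1" using h by (metis dvd_power_same power_one)
  then show False using irr by (auto simp: irreducible_def)
qed

lemma irreducible_factor_vdeg_pos:
  fixes h :: "('n::linorder, 'a::field) mpoly"
  assumes "vdeg x h > 0"
  shows "\<exists>p. irreducible p \<and> p dvd h \<and> vdeg x p > 0"
  using assms
proof (induction "tdeg h" arbitrary: h rule: less_induct)
  case less
  have h0: "h \<noteq> 0" using less.prems by (auto simp: as_upoly.hom_zero)
  moreover have "\<not> h dvd 1" using less.prems vdeg_unit[of h x] by auto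
  ultimately obtain p where p: "irreducible p" "p dvd h" by (rule mpoly_irreducible_factor)
  show ?case
  proof (cases "vdeg x p > 0")
    case False
    obtain k where k: "h = p * k" using p by (auto simp: dvd_def)
    then have nz: "p \<noteq> 0" "k \<noteq> 0" using h0 by auto
    have "tdeg p > 0" using p(1) nz mpoly_unit_iff[of p] by (auto simp: irreducible_def)
    then have "tdeg k < tdeg h" using nz by (simp add: k tdeg_mult)
    moreover have "vdeg x k > 0" using less.prems False nz by (simp add: k vdeg_mult)
    ultimately obtain q where "irreducible q" "q dvd k" "vdeg x q > 0" using less.hyps by blast
    then show ?thesis using k by auto
  qed (use p in auto)
qed

text \<open>Again Bezout with cleared denominators. If an element h of least x-degree in the ideal
  (p, q) still involves x, then so does some irreducible factor g of h. Pseudo-division shows that g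
  divides c r for each r in the ideal, with c nonzero and free of x; g is prime and cannot divide
  c.\<close>

lemma mpoly_bezout_or_common_factor:
  fixes p q :: "('n::linorder, 'a::field) mpoly"
  assumes "p \<noteq> 0"
  shows "(\<exists>s t. s * p + t * q \<noteq> 0 \<and> vdeg x (s * p + t * q) = 0) \<or>
    (\<exists>g. irreducible g \<and> g dvd p \<and> g dvd q \<and> vdeg x g > 0)"
proof -
  define I where "I = {s * p + t * q | s t. True}"
  have pI: "p \<in> I" unfolding I_def by (rule CollectI, rule exI[of _ 1], rule exI[of _ 0]) simp
  have qI: "q \<in> I" unfolding I_def by (rule CollectI, rule exI[of _ 0], rule exI[of _ 1]) simp
  have I_comb: "c * u - d * v \<in> I" if uv: "u \<in> I" "v \<in> I" for c u d v
  proof -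
    obtain s t s' t' where "u = s * p + t * q" "v = s' * p + t' * q"
      using uv unfolding I_def by blast
    then have "c * u - d * v = (c * s - d * s') * p + (c * t - d * t') * q"
      by (simp add: algebra_simps)
    then show ?thesis unfolding I_def by blast
  qed
  have "\<exists>h. h \<in> I \<and> h \<noteq> 0" using pI assms by auto
  then obtain h where h: "h \<in> I" "h \<noteq> 0" and
    min: "\<And>g. g \<in> I \<Longrightarrow> g \<noteq> 0 \<Longrightarrow> vdeg x h \<le> vdeg x g"
    using ex_has_least_nat[of "\<lambda>h. h \<in> I \<and> h \<noteq> 0" _ "vdeg x"] by blast
  show ?thesis
  proof (cases "vdeg x h = 0")
    case True
    then show ?thesis using h unfolding I_def by blast
  next
    case False
    then obtain g where g: "irreducible g" "g dvd h" "vdeg x g > 0"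
      using irreducible_factor_vdeg_pos by blast
    have "g dvd r" if r: "r \<in> I" for r
    proof -
      have UNIV: "a \<in> polys_in (insert x (UNIV - {x}))" for a :: "('n, 'a) mpoly" by (simp add: polys_in_def)
      obtain c d e where cde: "c \<in> polys_in (UNIV - {x})" "c \<noteq> 0"
        "c * r = d * h + e" "e = 0 \<or> vdeg x e < vdeg x h"
        using mpoly_pseudo_division[OF UNIV h(2) UNIV] by blast
      have "e = c * r - d * h" using cde(3) by simp
      then have "e \<in> I" using I_comb[OF r h(1), of c d] by simp
      then have "e = 0" using cde(4) min by force
      then have "g dvd c * r" using cde(3) g(2) by simp
      then have "g dvd c \<or> g dvd r"
        using mpoly_irreducible_imp_prime_elem[OF g(1)] by (simp add: prime_elem_dvd_mult_iff)
      moreover have "\<not> g dvd c"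
      proof
        assume "g dvd c"
        then obtain k where k: "c = g * k" by (auto simp: dvd_def)
        have "vdeg x c = 0" using cde(1) by (simp add: polys_in_def)
        then show False using g(3) cde(2) by (simp add: k vdeg_mult)
      qed
      ultimately show ?thesis by simp
    qed
    then show ?thesis using pI qI g by blast
  qed
qed

text \<open>
  Odd indices stand for the coordinates of a point, the index following an odd one for the
  corresponding coordinate of a direction, and index 0 for the parameter of the line.
\<close>

definition shear :: "(nat, 'a::comm_ring_1) mpoly \<Rightarrow> (nat, 'a) mpoly" where
  "shear = mp_eval mconst (\<lambda>j. if odd j then var j + var 0 * var (Suc j) else var j)"

definition unshear :: "(nat, 'a::comm_ring_1) mpoly \<Rightarrow> (nat, 'a) mpoly" where
  "unshear = mp_eval mconst (\<lambda>j. if odd j then var j - var 0 * var (Suc j) else var j)"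

interpretation shear: ring_hom_fun shear
  unfolding shear_def by (rule ring_hom_fun_mp_eval[OF ring_hom_fun_mconst])

interpretation unshear: ring_hom_fun unshear
  unfolding unshear_def by (rule ring_hom_fun_mp_eval[OF ring_hom_fun_mconst])

lemma shear_mconst [simp]: "shear (mconst c) = mconst c"
  by (simp add: shear_def mp_eval_mconst[OF ring_hom_fun_mconst])

lemma shear_var: "shear (var j) = (if odd j then var j + var 0 * var (Suc j) else var j)"
  by (simp add: shear_def mp_eval_var[OF ring_hom_fun_mconst])

lemma unshear_mconst [simp]: "unshear (mconst c) = mconst c"
  by (simp add: unshear_def mp_eval_mconst[OF ring_hom_fun_mconst])

lemma unshear_var: "unshear (var j) = (if odd j then var j - var 0 * var (Suc j) else var j)"
  by (simp add: unshear_def mp_eval_var[OF ring_hom_fun_mconst])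

lemma shear_unshear [simp]: "shear (unshear p) = p"
  by (rule mpoly_hom_eqI[OF ring_hom_fun_comp[OF shear.ring_hom_fun_axioms unshear.ring_hom_fun_axioms] ring_hom_fun_id])
     (auto simp: shear_var unshear_var shear.hom_diff shear.hom_mult)

lemma unshear_shear [simp]: "unshear (shear p) = p"
  by (rule mpoly_hom_eqI[OF ring_hom_fun_comp[OF unshear.ring_hom_fun_axioms shear.ring_hom_fun_axioms] ring_hom_fun_id])
     (auto simp: shear_var unshear_var unshear.hom_add unshear.hom_mult)

lemma irreducible_unshear:
  assumes "irreducible p"
  shows "irreducible (unshear p)"
proof (rule irreducibleI)
  show "unshear p \<noteq> 0"
  proof
    assume "unshear p = 0"
    then have "p = 0" by (metis shear_unshear shear.hom_zero)
    then show False using assms by auto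
  qed
  show "\<not> unshear p dvd 1" using shear.hom_unit[of "unshear p"] assms by (auto simp: irreducible_def)
  fix a b assume "unshear p = a * b"
  then have "p = shear a * shear b" by (metis shear_unshear shear.hom_mult)
  then have "shear a dvd 1 \<or> shear b dvd 1" using assms by (auto simp: irreducible_def)
  then show "a dvd 1 \<or> b dvd 1" using unshear.hom_unit[of "shear a"] unshear.hom_unit[of "shear b"] by auto
qed

text \<open>The derivative of g(X + T U) in T is the sum of U_j times the j-th partial derivative at
  X + T U. Specialising U to a coordinate vector isolates one partial derivative, and
  \<open>irreducible_pdiff_nonzero\<close> provides a nonzero one.\<close>

lemma pdiff_shear_nonzero:
  fixes g :: "(nat, 'a::alg_closed_field) mpoly"
  assumes char: "CHAR('a) > 0" and g: "irreducible g" "g \<in> polys_in {j. odd j}"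
  shows "pdiff 0 (shear g) \<noteq> 0"
proof
  assume z: "pdiff 0 (shear g) = 0"
  obtain j where j: "pdiff j g \<noteq> 0" using irreducible_pdiff_nonzero[OF char g(1)] by blast
  have "odd j"
  proof
    assume "even j"
    then have "as_upoly j g = [:g:]" using g(2) by (simp add: polys_in_iff)
    then show False using j by (simp add: pdiff_def)
  qed
  \<comment> \<open>\<open>\<tau>\<close> sets U to the j-th coordinate vector, which turns g(X + T
    U) into g with x_j replaced by x_j + T. \<open>\<rho>\<close> fixes g and kills the even
    variables, on which the two homomorphisms compared below need not agree.\<close>
  define \<rho> where "\<rho> = mp_eval mconst (\<lambda>i. if odd i then var i else 0 :: (nat, 'a) mpoly)"
  define \<tau> where "\<tau> = mp_eval mconst (\<lambda>i. if odd i then var i else if i = Suc j then 1 else 0 :: (nat, 'a) mpoly)"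
  have \<rho>: "ring_hom_fun \<rho>" and \<tau>: "ring_hom_fun \<tau>"
    unfolding \<rho>_def \<tau>_def by (rule ring_hom_fun_mp_eval[OF ring_hom_fun_mconst])+
  interpret \<rho>: ring_hom_fun \<rho> by (rule \<rho>)
  interpret \<tau>: ring_hom_fun \<tau> by (rule \<tau>)
  have \<rho>_simps: "\<rho> (mconst c) = mconst c" "\<rho> (var i) = (if odd i then var i else 0)" for c i
    by (simp_all add: \<rho>_def mp_eval_var[OF ring_hom_fun_mconst] mp_eval_mconst[OF ring_hom_fun_mconst])
  have \<tau>_simps: "\<tau> (mconst c) = mconst c"
    "\<tau> (var i) = (if odd i then var i else if i = Suc j then 1 else 0)" for c i
    by (simp_all add: \<tau>_def mp_eval_var[OF ring_hom_fun_mconst] mp_eval_mconst[OF ring_hom_fun_mconst])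
  have \<rho>g: "\<rho> g = g"
    using mp_eval_cong_polys_in[OF g(2), of var "\<lambda>i. if odd i then var i else 0" mconst]
    by (simp add: \<rho>_def mp_eval_mconst_var)
  have "map_poly \<tau> (as_upoly 0 (shear (\<rho> q))) = pcompose (as_upoly j (\<rho> q)) [:var j, 1:]" for q
  proof (rule mpoly_hom_eqI[where g = "\<lambda>q. map_poly \<tau> (as_upoly 0 (shear (\<rho> q)))"
        and h = "\<lambda>q. pcompose (as_upoly j (\<rho> q)) [:var j, 1:]"])
    show "ring_hom_fun (\<lambda>q. map_poly \<tau> (as_upoly 0 (shear (\<rho> q))))"
      by (intro ring_hom_fun_comp[OF ring_hom_fun_map_poly[OF \<tau>]]
          ring_hom_fun_comp[OF as_upoly.ring_hom_fun_axioms]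
          ring_hom_fun_comp[OF shear.ring_hom_fun_axioms] \<rho>)
    show "ring_hom_fun (\<lambda>q. pcompose (as_upoly j (\<rho> q)) [:var j, 1:])"
      by (intro ring_hom_fun_comp[OF ring_hom_fun_pcompose] ring_hom_fun_comp[OF as_upoly.ring_hom_fun_axioms] \<rho>)
    show "map_poly \<tau> (as_upoly 0 (shear (\<rho> (mconst c)))) = pcompose (as_upoly j (\<rho> (mconst c))) [:var j, 1:]" for c
      by (simp add: \<rho>_simps \<tau>_simps map_poly_pCons \<tau>.hom_zero)
    show "map_poly \<tau> (as_upoly 0 (shear (\<rho> (var i)))) = pcompose (as_upoly j (\<rho> (var i))) [:var j, 1:]" for i
      using \<open>odd j\<close>
      by (auto simp: \<rho>_simps \<tau>_simps shear_var as_upoly_var as_upoly.hom_add as_upoly.hom_mult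
          map_poly_pCons \<tau>.hom_zero as_upoly.hom_zero shear.hom_zero pcompose_pCons)
  qed
  from this[of g] have "map_poly \<tau> (as_upoly 0 (shear g)) = pcompose (as_upoly j g) [:var j, 1:]"
    by (simp add: \<rho>g)
  then have "pderiv (pcompose (as_upoly j g) [:var j, 1:]) = map_poly \<tau> (pderiv (as_upoly 0 (shear g)))"
    by (simp add: pderiv_map_poly[OF \<tau>, symmetric])
  also have "pderiv (as_upoly 0 (shear g)) = 0"
    using z by (simp add: as_upoly_pdiff[symmetric] as_upoly.hom_zero)
  finally have "pcompose (pderiv (as_upoly j g)) [:var j, 1:] = 0"
    by (simp add: pderiv_pcompose pderiv_pCons)
  then have "pderiv (as_upoly j g) = 0" by (subst (asm) pcompose_eq_0_iff) auto
  then show False using j by (simp add: pdiff_def)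
qed

text \<open>The combination obtained here is free of the parameter T and plays the role of a
  discriminant of f on the generic line. A common irreducible factor g involving T is impossible:
  writing \<open>shear f\<close> = g k, it would divide k, giving f a square factor, or its own
  T-derivative, which is nonzero of smaller degree in T.\<close>

lemma shear_separable:
  fixes f :: "(nat, 'a::alg_closed_field) mpoly"
  assumes char: "CHAR('a) > 0" and f: "f \<noteq> 0" "f \<in> polys_in {j. odd j}"
    and sqfree: "\<And>g. irreducible g \<Longrightarrow> \<not> g ^ 2 dvd f"
  obtains s t where "s * shear f + t * pdiff 0 (shear f) \<noteq> 0"
    "vdeg 0 (s * shear f + t * pdiff 0 (shear f)) = 0"
proof -
  have "shear f \<noteq> 0" using f(1) by (metis unshear_shear unshear.hom_zero)
  moreover have False if g: "irreducible g" "g dvd shear f" "g dvd pdiff 0 (shear f)" "vdeg 0 g > 0" for g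
  proof -
    obtain k where k: "shear f = g * k" using g(2) by (auto simp: dvd_def)
    then have fk: "f = unshear g * unshear k" by (metis unshear_shear unshear.hom_mult)
    have prime: "prime_elem g" using g(1) by (rule mpoly_irreducible_imp_prime_elem)
    have irr: "irreducible (unshear g)" using g(1) by (rule irreducible_unshear)
    \<comment> \<open>As a factor of f, \<open>unshear g\<close> involves point coordinates only, so
      \<open>pdiff_shear_nonzero\<close> applies to it.\<close>
    have "unshear g \<in> polys_in {j. odd j}"
      using f fk polys_in_factor by blast
    then have nz: "pdiff 0 g \<noteq> 0" using pdiff_shear_nonzero[OF char irr] by simp
    have "g dvd g * pdiff 0 k + k * pdiff 0 g" using g(3) by (simp add: k pdiff_mult)
    then have "g dvd k * pdiff 0 g" by (simp add: dvd_add_right_iff)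
    then have "g dvd k \<or> g dvd pdiff 0 g" using prime by (simp add: prime_elem_dvd_mult_iff)
    then show False
    proof
      assume "g dvd k"
      then have "unshear g dvd unshear k" by (rule unshear.hom_dvd)
      then have "unshear g ^ 2 dvd f" unfolding fk power2_eq_square by (rule mult_dvd_mono[OF dvd_refl])
      then show False using sqfree irr by blast
    next
      assume "g dvd pdiff 0 g"
      then obtain l where l: "pdiff 0 g = g * l" by (auto simp: dvd_def)
      then have "g \<noteq> 0" "l \<noteq> 0" using nz by auto
      then have "vdeg 0 (pdiff 0 g) \<ge> vdeg 0 g" by (simp add: l vdeg_mult)
      moreover have "vdeg 0 (pdiff 0 g) \<le> vdeg 0 g - 1"
        unfolding as_upoly_pdiff by (rule degree_le) (simp add: coeff_pderiv coeff_eq_0)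
      ultimately show False using g(4) by simp
    qed
  qed
  ultimately have "\<exists>s t. s * shear f + t * pdiff 0 (shear f) \<noteq> 0 \<and>
      vdeg 0 (s * shear f + t * pdiff 0 (shear f)) = 0"
    using mpoly_bezout_or_common_factor[of "shear f" "pdiff 0 (shear f)" 0] by metis
  then show ?thesis using that by metis
qed

section \<open>Points and lines in general position\<close>

lemma infinite_UNIV_alg_closed: "infinite (UNIV :: 'a::alg_closed_field set)"
proof
  assume fin: "finite (UNIV :: 'a set)"
  define p where "p = (\<Prod>x\<in>UNIV. [:- x, 1:]) + (1 :: 'a poly)"
  have "degree (\<Prod>x\<in>(UNIV :: 'a set). [:- x, 1:]) = card (UNIV :: 'a set)"
    by (subst degree_prod_eq_sum_degree) auto
  then have "degree (\<Prod>x\<in>(UNIV :: 'a set). [:- x, 1:]) > 0"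
    using fin by (simp add: card_gt_0_iff)
  then have "degree p > 0" unfolding p_def by (subst degree_add_eq_left) auto
  then obtain x where "poly p x = 0" using alg_closed_imp_poly_has_root by blast
  moreover have "poly (\<Prod>x\<in>(UNIV :: 'a set). [:- x, 1:]) x = 0"
    using fin by (auto simp: poly_prod prod_zero_iff intro!: bexI[of _ x])
  ultimately show False by (simp add: p_def)
qed

lemma mpoly_nonroot_exists:
  fixes r :: "('n::linorder, 'a::idom) mpoly"
  assumes inf: "infinite (UNIV :: 'a set)" and "r \<noteq> 0"
  shows "\<exists>w. mp_eval (\<lambda>c. c) w r \<noteq> 0"
proof -
  obtain V where "finite V" "r \<in> polys_in V" by (rule polys_in_finite_support)
  then show ?thesis
    using \<open>r \<noteq> 0\<close>
  proof (induction V arbitrary: r rule: finite_induct)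
    case empty
    obtain c where c: "r = mconst c" using polys_in_empty[OF empty.prems(1)] by blast
    then have "c \<noteq> 0" using empty.prems(2) by (auto simp: mconst_def)
    then show ?case using c by (simp add: mp_eval_mconst[OF ring_hom_fun_id])
  next
    case (insert x V)
    have "finite {y. poly (as_upoly x r) y = 0}"
      using insert.prems(2) by (intro poly_roots_finite) simp
    moreover have "inj (mconst :: 'a \<Rightarrow> ('n, 'a) mpoly)" by (metis injI mconst_def lookup_single_eq)
    ultimately have "finite (mconst -` {y. poly (as_upoly x r) y = 0})" by (rule finite_vimageI)
    then obtain a where a: "poly (as_upoly x r) (mconst a) \<noteq> 0"
      using inf by (metis (mono_tags, lifting) UNIV_eq_I mem_Collect_eq vimageI)
    have "poly (as_upoly x r) (mconst a) \<in> polys_in V"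
      unfolding poly_altdef using polys_in_coeff[OF insert.prems(1)] by (intro polys_in_sum) simp
    then obtain w where w: "mp_eval (\<lambda>c. c) w (poly (as_upoly x r) (mconst a)) \<noteq> 0"
      using insert.IH a by blast
    have "mp_eval (\<lambda>c. c) w (poly (as_upoly x q) (mconst a)) = mp_eval (\<lambda>c. c) (w(x := a)) q" for q
    proof (rule mpoly_hom_eqI[where g = "\<lambda>q. mp_eval (\<lambda>c. c) w (poly (as_upoly x q) (mconst a))"])
      show "ring_hom_fun (\<lambda>q. mp_eval (\<lambda>c. c) w (poly (as_upoly x q) (mconst a)))"
        by (intro ring_hom_fun_comp[OF ring_hom_fun_mp_eval[OF ring_hom_fun_id]]
            ring_hom_fun_comp[OF ring_hom_fun_poly] as_upoly.ring_hom_fun_axioms)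
    qed (simp_all add: ring_hom_fun_mp_eval[OF ring_hom_fun_id] as_upoly_var
        mp_eval_var[OF ring_hom_fun_id] mp_eval_mconst[OF ring_hom_fun_id])
    then show ?case using w by metis
  qed
qed

lemma coeff_mult_bound:
  assumes "degree p \<le> m" "degree q \<le> n"
  shows "coeff (p * q) (m + n) = coeff p m * coeff q n"
proof -
  have "coeff (p * q) (m + n) = (\<Sum>i\<le>m + n. coeff p i * coeff q (m + n - i))"
    by (rule coeff_mult)
  also have "\<dots> = (\<Sum>i\<in>{m}. coeff p i * coeff q (m + n - i))"
  proof (intro sum.mono_neutral_right ballI)
    fix i assume "i \<in> {..m + n} - {m}"
    then have "i > m \<or> m + n - i > n" by auto
    then show "coeff p i * coeff q (m + n - i) = 0" using assms by (auto simp: coeff_eq_0)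
  qed auto
  finally show ?thesis by simp
qed

lemma linear_monom_eval_degree:
  fixes a b :: "'a \<Rightarrow> 'b::comm_ring_1"
  shows "degree (monom_eval (\<lambda>i. [:a i, b i:]) m) \<le> (\<Sum>i\<in>Poly_Mapping.keys m. Poly_Mapping.lookup m i) \<and>
   coeff (monom_eval (\<lambda>i. [:a i, b i:]) m) (\<Sum>i\<in>Poly_Mapping.keys m. Poly_Mapping.lookup m i) = monom_eval b m"
proof -
  have pow: "degree ([:c, e:] ^ k) \<le> k \<and> coeff ([:c, e:] ^ k) k = e ^ k" for c e :: 'b and k
  proof (induction k)
    case (Suc k)
    have "degree ([:c, e:] * [:c, e:] ^ k) \<le> degree [:c, e:] + degree ([:c, e:] ^ k)" by (rule degree_mult_le)
    also have "\<dots> \<le> 1 + k" using Suc by (intro add_mono) auto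
    finally have "degree ([:c, e:] * [:c, e:] ^ k) \<le> Suc k" by simp
    moreover have "coeff ([:c, e:] * [:c, e:] ^ k) (1 + k) = coeff [:c, e:] 1 * coeff ([:c, e:] ^ k) k"
      using Suc by (intro coeff_mult_bound) auto
    ultimately show ?case using Suc by simp
  qed simp
  have "degree (\<Prod>i\<in>A. [:a i, b i:] ^ g i) \<le> sum g A \<and>
      coeff (\<Prod>i\<in>A. [:a i, b i:] ^ g i) (sum g A) = (\<Prod>i\<in>A. b i ^ g i)" if "finite A" for A and g :: "'a \<Rightarrow> nat"
    using that
  proof (induction A rule: finite_induct)
    case (insert x A)
    have "degree ([:a x, b x:] ^ g x * (\<Prod>i\<in>A. [:a i, b i:] ^ g i)) \<le> g x + sum g A"
      using insert.IH pow[of "a x" "b x" "g x"] by (intro order_trans[OF degree_mult_le] add_mono) auto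
    moreover have "coeff ([:a x, b x:] ^ g x * (\<Prod>i\<in>A. [:a i, b i:] ^ g i)) (g x + sum g A) =
        coeff ([:a x, b x:] ^ g x) (g x) * coeff (\<Prod>i\<in>A. [:a i, b i:] ^ g i) (sum g A)"
      using insert.IH pow[of "a x" "b x" "g x"] by (intro coeff_mult_bound) auto
    ultimately show ?case using insert pow[of "a x" "b x" "g x"] by simp
  qed simp
  then show ?thesis by (simp add: monom_eval_def)
qed

lemma homogeneous_keys:
  fixes f :: "('n::finite, 'a::zero) mpoly"
  assumes "homogeneous_of_degree d f" "m \<in> Poly_Mapping.keys f"
  shows "(\<Sum>i\<in>Poly_Mapping.keys m. Poly_Mapping.lookup m i) = d"
proof -
  have "(\<Sum>i\<in>Poly_Mapping.keys m. Poly_Mapping.lookup m i) = (\<Sum>i\<in>UNIV. Poly_Mapping.lookup m i)"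
    by (intro sum.mono_neutral_left) (auto simp: in_keys_iff)
  then show ?thesis using assms by (simp add: homogeneous_of_degree_def)
qed

text \<open>For a form f this is the dehomogenised restriction to the plane spanned by v and u,
  namely f(s v + t u) at s = 1.\<close>

definition on_line :: "('n \<Rightarrow> 'a) \<Rightarrow> ('n \<Rightarrow> 'a) \<Rightarrow> ('n, 'a::comm_ring_1) mpoly \<Rightarrow> 'a poly" where
  "on_line v u = mp_eval (\<lambda>c. [:c:]) (\<lambda>i. [:v i, u i:])"

interpretation on_line: ring_hom_fun "on_line v u"
  unfolding on_line_def by (rule ring_hom_fun_mp_eval[OF ring_hom_fun_const_poly])

text \<open>The coefficient of T^d is the value at the direction u, the point at infinity of the
  line. Choosing f(u) nonzero therefore keeps the full degree d, so that the binary form has no root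
  at infinity.\<close>

lemma on_line_homogeneous:
  fixes f :: "('n::finite, 'a::comm_ring_1) mpoly"
  assumes "homogeneous_of_degree d f"
  shows "degree (on_line v u f) \<le> d" "coeff (on_line v u f) d = mp_eval (\<lambda>c. c) u f"
proof -
  have "degree (monom_eval (\<lambda>i. [:v i, u i:]) m) \<le> d \<and>
      coeff (monom_eval (\<lambda>i. [:v i, u i:]) m) d = monom_eval u m" if "m \<in> Poly_Mapping.keys f" for m
    using linear_monom_eval_degree[of v u m] homogeneous_keys[OF assms that] by simp
  then show "degree (on_line v u f) \<le> d" "coeff (on_line v u f) d = mp_eval (\<lambda>c. c) u f"
    unfolding on_line_def mp_eval_def
    by (auto intro!: degree_sum_le order_trans[OF degree_smult_le] simp: coeff_sum)
qed

text \<open>Evaluating the Bezout relation of \<open>shear_separable\<close> at a point w where its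
  right-hand side is nonzero makes that side a nonzero constant. The polynomial U carries one more
  open condition on w; it will be f written in the direction variables, so that the degree does not
  drop.\<close>

lemma separable_line_nat:
  fixes f :: "(nat, 'a::alg_closed_field) mpoly" and U :: "(nat, 'a) mpoly"
  assumes char: "CHAR('a) > 0" and f: "f \<noteq> 0" "f \<in> polys_in {j. odd j}" and U: "U \<noteq> 0"
    and sqfree: "\<And>g. irreducible g \<Longrightarrow> \<not> g ^ 2 dvd f"
  obtains w A B where "mp_eval (\<lambda>c. c) w U \<noteq> 0"
    "A * on_line w (\<lambda>j. w (Suc j)) f + B * pderiv (on_line w (\<lambda>j. w (Suc j)) f) = 1"
proof -
  obtain s t where st: "s * shear f + t * pdiff 0 (shear f) \<noteq> 0"
    "vdeg 0 (s * shear f + t * pdiff 0 (shear f)) = 0"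
    using shear_separable[OF char f sqfree] by blast
  define r where "r = s * shear f + t * pdiff 0 (shear f)"
  have "r * U \<noteq> 0" using st(1) U by (simp add: r_def)
  then obtain w where w: "mp_eval (\<lambda>c. c) w (r * U) \<noteq> 0"
    using mpoly_nonroot_exists[OF infinite_UNIV_alg_closed] by blast
  interpret ev: ring_hom_fun "mp_eval (\<lambda>c. c) w"
    by (rule ring_hom_fun_mp_eval[OF ring_hom_fun_id])
  have rU: "mp_eval (\<lambda>c. c) w r \<noteq> 0" "mp_eval (\<lambda>c. c) w U \<noteq> 0"
    using w by (auto simp: ev.hom_mult)
  \<comment> \<open>Evaluation at w of every variable except the parameter \<open>var 0\<close>,
    which remains as the univariate indeterminate.\<close>
  define E where "E = mp_eval (\<lambda>c. [:c:]) (\<lambda>j. if j = 0 then [:0, 1:] else [:w j:])"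
  interpret E: ring_hom_fun E unfolding E_def by (rule ring_hom_fun_mp_eval[OF ring_hom_fun_const_poly])
  have E_simps: "E (mconst c) = [:c:]" "E (var j) = (if j = 0 then [:0, 1:] else [:w j:])" for c j
    by (simp_all add: E_def mp_eval_var[OF ring_hom_fun_const_poly] mp_eval_mconst[OF ring_hom_fun_const_poly])
  have E_eq: "E q = map_poly (mp_eval (\<lambda>c. c) w) (as_upoly 0 q)" for q
    by (rule mpoly_hom_eqI[OF E.ring_hom_fun_axioms ring_hom_fun_comp[OF ring_hom_fun_map_poly[OF ev.ring_hom_fun_axioms] as_upoly.ring_hom_fun_axioms]])
       (auto simp: E_simps as_upoly_var map_poly_pCons ev.hom_zero ev.hom_one
          mp_eval_var[OF ring_hom_fun_id] mp_eval_mconst[OF ring_hom_fun_id])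
  have E_pdiff: "E (pdiff 0 q) = pderiv (E q)" for q
    by (simp add: E_eq as_upoly_pdiff pderiv_map_poly[OF ev.ring_hom_fun_axioms])
  have Er: "E r = [:mp_eval (\<lambda>c. c) w r:]"
    using st(2) by (simp add: E_eq r_def[symmetric] as_upoly_degree_0 map_poly_pCons ev.hom_zero)
  have "E (shear f) = mp_eval (\<lambda>c. [:c:]) (\<lambda>j. E (if odd j then var j + var 0 * var (Suc j) else var j)) f"
    unfolding shear_def by (simp add: E.hom_mp_eval E_simps)
  also have "\<dots> = on_line w (\<lambda>j. w (Suc j)) f"
    unfolding on_line_def
    by (rule mp_eval_cong_polys_in[OF f(2)]) (auto simp: E_simps E.hom_add E.hom_mult odd_pos)
  finally have Ef: "E (shear f) = on_line w (\<lambda>j. w (Suc j)) f" .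
  define c where "c = inverse (mp_eval (\<lambda>c. c) w r)"
  have "smult c (E s) * E (shear f) + smult c (E t) * pderiv (E (shear f)) = smult c (E r)"
    by (simp add: r_def E.hom_add E.hom_mult E_pdiff smult_add_right)
  also have "\<dots> = 1" using rU(1) by (simp add: Er c_def one_pCons)
  finally show ?thesis using that[OF rU(2)] unfolding Ef by blast
qed

text \<open>The variables are moved to odd natural numbers, which supplies the linear order needed
  for factorization and leaves even indices free for directions. Here \<open>emb\<close> uses point
  variables and \<open>emb'\<close> direction variables; \<open>ret\<close> and \<open>ret'\<close>
  are left inverses, and \<open>ret\<close> carries irreducibles in the image variables back to the
  original ring.\<close>

lemma separable_line:
  fixes f :: "('n::finite, 'a::alg_closed_field) mpoly"
  assumes char: "CHAR('a) > 0"
    and hom: "homogeneous_of_degree d f"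
    and sqfree: "\<And>g :: ('n, 'a) mpoly. irreducible g \<Longrightarrow> \<not> g ^ 2 dvd f"
  obtains v u A B where "degree (on_line v u f) = d"
    "A * on_line v u f + B * pderiv (on_line v u f) = 1"
proof -
  obtain e :: "'n \<Rightarrow> nat" where e: "inj e" using finite_imp_inj_to_nat_seg[of "UNIV :: 'n set"] by auto
  define k where "k i = Suc (2 * e i)" for i
  have k: "inj k" "range k \<subseteq> {j. odd j}" using e by (auto simp: k_def inj_def)
  define emb where "emb = mp_eval mconst (\<lambda>i. var (k i) :: (nat, 'a) mpoly)"
  define emb' where "emb' = mp_eval mconst (\<lambda>i. var (Suc (k i)) :: (nat, 'a) mpoly)"
  define ret where "ret = mp_eval mconst (\<lambda>j. var (inv_into UNIV k j) :: ('n, 'a) mpoly)"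
  define ret' where "ret' = mp_eval mconst (\<lambda>j. var (inv_into UNIV k (j - 1)) :: ('n, 'a) mpoly)"
  have homs: "ring_hom_fun emb" "ring_hom_fun emb'" "ring_hom_fun ret" "ring_hom_fun ret'"
    unfolding emb_def emb'_def ret_def ret'_def by (rule ring_hom_fun_mp_eval[OF ring_hom_fun_mconst])+
  interpret emb: ring_hom_fun emb by (rule homs)
  interpret emb': ring_hom_fun emb' by (rule homs)
  interpret ret: ring_hom_fun ret by (rule homs)
  interpret ret': ring_hom_fun ret' by (rule homs)
  note simps = mp_eval_var[OF ring_hom_fun_mconst] mp_eval_mconst[OF ring_hom_fun_mconst]
  have ret_emb: "ret (emb q) = q" for q
    by (rule mpoly_hom_eqI[OF ring_hom_fun_comp[OF homs(3,1)] ring_hom_fun_id])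
       (simp_all add: ret_def emb_def simps k(1))
  have ret_emb': "ret' (emb' q) = q" for q
    by (rule mpoly_hom_eqI[OF ring_hom_fun_comp[OF homs(4,2)] ring_hom_fun_id])
       (simp_all add: ret'_def emb'_def simps k(1))
  have emb_in: "emb q \<in> polys_in (range k)" for q
    unfolding emb_def mp_eval_def monom_eval_def
    by (intro polys_in_sum polys_in_mult polys_in_prod) auto
  have emb_ret: "emb (ret q) = q" if "q \<in> polys_in (range k)" for q
  proof -
    have "emb (ret q) = mp_eval mconst (\<lambda>j. var (k (inv_into UNIV k j))) q"
      unfolding ret_def by (simp add: emb.hom_mp_eval) (simp add: emb_def simps)
    also have "\<dots> = mp_eval mconst var q"
      by (rule mp_eval_cong_polys_in[OF that]) (auto simp: f_inv_into_f)
    finally show ?thesis by (simp add: mp_eval_mconst_var)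
  qed
  have irreducible_ret: "irreducible (ret g)" if g: "irreducible g" "g \<in> polys_in (range k)" for g
  proof (rule irreducibleI)
    note emb_ret_g = emb_ret[OF g(2)]
    show "ret g \<noteq> 0" using emb_ret_g g(1) by (auto simp: emb.hom_zero)
    show "\<not> ret g dvd 1" using emb.hom_unit[of "ret g"] emb_ret_g g(1) by (auto simp: irreducible_def)
    fix a b assume "ret g = a * b"
    then have "g = emb a * emb b" using emb_ret_g by (simp add: emb.hom_mult)
    then have "emb a dvd 1 \<or> emb b dvd 1" using g(1) by (auto simp: irreducible_def)
    then show "a dvd 1 \<or> b dvd 1" using ret.hom_unit[of "emb a"] ret.hom_unit[of "emb b"] by (auto simp: ret_emb)
  qed
  \<comment> \<open>The square of any irreducible divides 0, so it suffices that an irreducible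
    exists; a factor of a variable provides one.\<close>
  have "f \<noteq> 0"
  proof
    assume "f = 0"
    fix i :: 'n
    have nz: "(var (k i) :: (nat, 'a) mpoly) \<noteq> 0" by (metis lookup_single_eq lookup_zero one_neq_zero var_def)
    then have "\<not> (var (k i) :: (nat, 'a) mpoly) dvd 1" by (simp add: mpoly_unit_iff)
    then obtain g :: "(nat, 'a) mpoly" where g: "irreducible g" "g dvd var (k i)"
      using mpoly_irreducible_factor nz by blast
    then obtain h where h: "var (k i) = g * h" by (auto simp: dvd_def)
    have "(var (k i) :: (nat, 'a) mpoly) \<in> polys_in (range k)" by simp
    then have "g \<in> polys_in (range k)" using nz unfolding h by (rule polys_in_factor)
    then have "irreducible (ret g)" using g(1) irreducible_ret by blast
    then show False using sqfree[of "ret g"] \<open>f = 0\<close> by simp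
  qed
  then have f0: "emb f \<noteq> 0" "emb' f \<noteq> 0"
    using ret_emb[of f] ret_emb'[of f] by (auto simp: ret.hom_zero ret'.hom_zero)
  have f_odd: "emb f \<in> polys_in {j. odd j}" using emb_in polys_in_mono[OF k(2)] by blast
  have sq: "\<not> g ^ 2 dvd emb f" if g: "irreducible g" for g
  proof
    assume dvd: "g ^ 2 dvd emb f"
    then obtain h where "emb f = g * (g * h)" by (auto simp: dvd_def power2_eq_square mult.assoc)
    then have "g \<in> polys_in (range k)" using emb_in[of f] f0(1) polys_in_factor(1)[of g "g * h"] by simp
    then have "irreducible (ret g)" using g irreducible_ret by blast
    moreover have "ret g ^ 2 dvd f" using ret.hom_dvd[OF dvd] by (simp add: ret_emb ret.hom_power)
    ultimately show False using sqfree by blast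
  qed
  obtain w A B where w: "mp_eval (\<lambda>c. c) w (emb' f) \<noteq> 0"
    "A * on_line w (\<lambda>j. w (Suc j)) (emb f) + B * pderiv (on_line w (\<lambda>j. w (Suc j)) (emb f)) = 1"
    using separable_line_nat[OF char f0(1) f_odd f0(2) sq] by blast
  have line: "on_line w (\<lambda>j. w (Suc j)) (emb f) = on_line (\<lambda>i. w (k i)) (\<lambda>i. w (Suc (k i))) f"
    unfolding emb_def on_line.hom_mp_eval
    by (simp add: on_line_def mp_eval_var[OF ring_hom_fun_const_poly] mp_eval_mconst[OF ring_hom_fun_const_poly])
  have "mp_eval (\<lambda>c. c) w (emb' f) = mp_eval (\<lambda>c. c) (\<lambda>i. w (Suc (k i))) f"
    unfolding emb'_def ring_hom_fun.hom_mp_eval[OF ring_hom_fun_mp_eval[OF ring_hom_fun_id]]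
    by (simp add: mp_eval_var[OF ring_hom_fun_id] mp_eval_mconst[OF ring_hom_fun_id])
  then have "degree (on_line (\<lambda>i. w (k i)) (\<lambda>i. w (Suc (k i))) f) = d"
    using w(1) on_line_homogeneous[OF hom, of "\<lambda>i. w (k i)" "\<lambda>i. w (Suc (k i))"]
    by (intro antisym le_degree) auto
  then show ?thesis using that w(2) unfolding line by blast
qed

section \<open>Powers of binary forms\<close>

text \<open>
  A binary form of degree \<open>D\<close>, dehomogenised to a univariate polynomial, lies in
  \<open>\<langle>x\<^sup>q, y\<^sup>q\<rangle>\<close> iff the coefficients of all \<open>x\<^sup>i y\<^bsup>D-i\<^esup>\<close> with \<open>i < q\<close> and \<open>D - i < q\<close> vanish.
\<close>

definition in_frob :: "nat \<Rightarrow> nat \<Rightarrow> 'a::comm_ring_1 poly \<Rightarrow> bool" where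
  "in_frob q D A \<longleftrightarrow> (\<forall>i. i < q \<longrightarrow> D < i + q \<longrightarrow> coeff A i = 0)"

lemma in_frob_0 [simp]: "in_frob q D 0"
  by (simp add: in_frob_def)

lemma in_frob_add: "in_frob q D A \<Longrightarrow> in_frob q D B \<Longrightarrow> in_frob q D (A + B)"
  by (simp add: in_frob_def)

lemma in_frob_smult: "in_frob q D A \<Longrightarrow> in_frob q D (smult c A)"
  by (simp add: in_frob_def)

lemma in_frob_sum: "(\<And>i. i \<in> I \<Longrightarrow> in_frob q D (g i)) \<Longrightarrow> in_frob q D (sum g I)"
  by (induction I rule: infinite_finite_induct) (auto intro: in_frob_add)

lemma in_frob_mult:
  assumes "in_frob q D A" "degree B \<le> b"
  shows "in_frob q (D + b) (A * B)"
  unfolding in_frob_def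
proof (intro allI impI)
  fix k assume k: "k < q" "D + b < k + q"
  have "coeff A i * coeff B (k - i) = 0" if "i \<le> k" for i
  proof (cases "k - i > b")
    case True
    then show ?thesis using assms(2) by (simp add: coeff_eq_0)
  next
    case False
    then have "i < q" "D < i + q" using that k by auto
    then show ?thesis using assms(1) by (simp add: in_frob_def)
  qed
  then show "coeff (A * B) k = 0" by (simp add: coeff_mult)
qed

text \<open>Derivations kill x^q and y^q when q = 0 in k, so they map the ideal into itself. In
  coefficients, the only index i for which i + 1 leaves the controlled range is q - 1, and there the
  factor q appears.\<close>

lemma in_frob_pderiv:
  fixes A :: "'a::idom poly"
  assumes "of_nat q = (0 :: 'a)" "in_frob q (Suc D) A"
  shows "in_frob q D (pderiv A)"
  unfolding in_frob_def
proof (intro allI impI)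
  fix i assume i: "i < q" "D < i + q"
  show "coeff (pderiv A) i = 0"
  proof (cases "Suc i = q")
    case True
    then show ?thesis using assms(1) by (simp add: coeff_pderiv del: of_nat_Suc)
  next
    case False
    then show ?thesis using assms(2) i by (simp add: coeff_pderiv in_frob_def)
  qed
qed

text \<open>By Euler's formula, deg(F) F - x F_x = y F_y; setting y = 1 identifies the polynomial
  here as the dehomogenised derivative in the other variable. The boundary coefficient now carries
  the factor D + 1 - i = q.\<close>

lemma in_frob_pderiv_dual:
  fixes A :: "'a::idom poly"
  assumes "of_nat q = (0 :: 'a)" "in_frob q (Suc D) A"
  shows "in_frob q D (smult (of_nat (Suc D)) A - pCons 0 (pderiv A))"
  unfolding in_frob_def
proof (intro allI impI)
  fix i assume i: "i < q" "D < i + q"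
  have c: "coeff (pCons 0 (pderiv A)) i = of_nat i * coeff A i"
    by (cases i) (simp_all add: coeff_pderiv)
  show "coeff (smult (of_nat (Suc D)) A - pCons 0 (pderiv A)) i = 0"
  proof (cases "Suc D = i + q")
    case True
    have "of_nat (Suc D) = (of_nat i :: 'a)" unfolding True using assms(1) by simp
    then show ?thesis by (simp add: c del: of_nat_Suc)
  next
    case False
    then show ?thesis using assms(2) i by (simp add: c in_frob_def)
  qed
qed

lemma degree_dual_pderiv_le:
  fixes P :: "'a::idom poly"
  shows "degree (smult (of_nat (degree P)) P - pCons 0 (pderiv P)) \<le> degree P - 1"
proof (rule degree_le, intro allI impI)
  fix i assume i: "degree P - 1 < i"
  have c: "coeff (pCons 0 (pderiv P)) i = of_nat i * coeff P i"
    by (cases i) (simp_all add: coeff_pderiv)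
  show "coeff (smult (of_nat (degree P)) P - pCons 0 (pderiv P)) i = 0"
    using i c by (cases "i = degree P") (auto simp: coeff_eq_0)
qed

lemma degree_pderiv_le: "degree (pderiv P) \<le> degree P - 1"
  by (rule degree_le) (simp add: coeff_pderiv coeff_eq_0)

text \<open>
  In homogeneous terms: the forms of degree \<open>2d - 3\<close> lie in the ideal generated by \<open>F\<close>, \<open>F\<^sub>x\<close>, \<open>F\<^sub>y\<close>.
  If the characteristic divides \<open>d\<close>, Euler's formula makes \<open>F\<^sub>x\<close> and \<open>F\<^sub>y\<close> proportional, so that \<open>F\<close>
  itself is needed; otherwise \<open>F\<close> is redundant.
\<close>

lemma jacobian_ideal_top_degree:
  fixes P S A0 B0 :: "'a::field poly"
  defines "Q \<equiv> smult (of_nat (degree P)) P - pCons 0 (pderiv P)"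
  assumes d: "d = degree P" "d \<ge> 2" and bezout: "A0 * P + B0 * pderiv P = 1"
    and S: "degree S \<le> 2 * d - 3"
  obtains \<alpha> \<beta> \<gamma> where "S = \<alpha> * pderiv P + \<beta> * Q + \<gamma> * P"
    "degree \<alpha> \<le> d - 2" "degree \<beta> \<le> d - 2" "\<gamma> = 0 \<or> degree \<gamma> + d \<le> 2 * d - 3"
proof (cases "of_nat d = (0 :: 'a)")
  case False
  have "coeff (pderiv P) (d - 1) = of_nat d * lead_coeff P" using d by (simp add: coeff_pderiv flip: d(1))
  also have "\<dots> \<noteq> 0" using False d by auto
  finally have c: "coeff (pderiv P) (d - 1) \<noteq> 0" .
  then have deg': "degree (pderiv P) = d - 1"
    using le_degree[OF c] degree_pderiv_le[of P] d(1) by simp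
  have P'0: "pderiv P \<noteq> 0" using c by auto
  define i where "i = inverse (of_nat d :: 'a)"
  \<comment> \<open>Euler's formula solved for P, possible because d is invertible.\<close>
  have P: "P = smult i Q + smult i (pCons 0 1) * pderiv P"
    using False by (simp add: Q_def i_def smult_diff_right flip: d(1))
  define \<beta>0 where "\<beta>0 = smult i (S * A0)"
  \<comment> \<open>Reducing modulo the derivative bounds the degree of \<open>\<beta>\<close>; the
    quotient is absorbed into \<open>\<alpha>\<close>, whose degree is then forced by the identity
    for S.\<close>
  define \<beta> where "\<beta> = \<beta>0 mod pderiv P"
  define \<alpha> where "\<alpha> = S * B0 + smult i (S * A0) * pCons 0 1 + (\<beta>0 div pderiv P) * Q"
  have "S = S * (A0 * P + B0 * pderiv P)" by (simp add: bezout)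
  also have "\<dots> = S * A0 * (smult i Q + smult i (pCons 0 1) * pderiv P) + S * B0 * pderiv P"
    by (subst (1) P) (simp add: algebra_simps)
  also have "\<dots> = \<beta>0 * Q + (S * B0 + smult i (S * A0) * pCons 0 1) * pderiv P"
    by (simp add: \<beta>0_def algebra_simps smult_add_right)
  also have "\<beta>0 = \<beta>0 div pderiv P * pderiv P + \<beta>" unfolding \<beta>_def by simp
  finally have eq: "S = \<alpha> * pderiv P + \<beta> * Q" by (simp add: \<alpha>_def algebra_simps)
  have \<beta>: "degree \<beta> \<le> d - 2"
    using degree_mod_less[OF P'0, of \<beta>0] deg' d(2) by (auto simp: \<beta>_def)
  have "degree (\<beta> * Q) \<le> (d - 2) + (d - 1)"
    using \<beta> degree_dual_pderiv_le[of P] d(1)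
    by (intro order_trans[OF degree_mult_le] add_mono) (simp_all add: Q_def)
  moreover have "\<alpha> * pderiv P = S - \<beta> * Q" using eq by simp
  ultimately have "degree (\<alpha> * pderiv P) \<le> 2 * d - 3"
    using S d(2) by (simp add: degree_diff_le)
  then have "degree \<alpha> \<le> d - 2"
    using P'0 deg' d(2) by (cases "\<alpha> = 0") (simp_all add: degree_mult_eq)
  then show ?thesis using that[of \<alpha> \<beta> 0] eq \<beta> by simp
next
  case True
  have Q: "Q = - pCons 0 (pderiv P)" using True by (simp add: Q_def flip: d(1))
  have P0: "P \<noteq> 0" using d by auto
  have deg': "degree (pderiv P) \<le> d - 2"
  proof (rule degree_le, intro allI impI)
    fix j assume "d - 2 < j"
    then have "Suc j = d \<or> Suc j > d" by auto
    then show "coeff (pderiv P) j = 0"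
      using True d(1) by (auto simp: coeff_pderiv coeff_eq_0 simp del: of_nat_Suc)
  qed
  define a where "a = (S * B0) mod P"
  define \<gamma> where "\<gamma> = S * A0 + (S * B0) div P * pderiv P"
  have "S = S * (A0 * P + B0 * pderiv P)" by (simp add: bezout)
  also have "\<dots> = S * A0 * P + S * B0 * pderiv P" by (simp add: algebra_simps)
  also have "S * B0 = (S * B0) div P * P + a" unfolding a_def by simp
  finally have eq: "S = a * pderiv P + \<gamma> * P" by (simp add: \<gamma>_def algebra_simps)
  have a: "degree a \<le> d - 1"
    using degree_mod_less[OF P0, of "S * B0"] d by (auto simp: a_def)
  \<comment> \<open>The coefficient a may have degree d - 1, one too many. Since Q is minus T times
    the derivative of P, everything beyond the constant term of a can be transferred to Q.\<close>
  obtain a0 a' where a0: "a = pCons a0 a'" by (cases a)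
  have a': "degree a' \<le> d - 2" using a unfolding a0 by (cases "a' = 0") auto
  have "degree (a * pderiv P) \<le> (d - 1) + (d - 2)"
    using a deg' by (intro order_trans[OF degree_mult_le] add_mono)
  moreover have "\<gamma> * P = S - a * pderiv P" using eq by simp
  ultimately have "degree (\<gamma> * P) \<le> 2 * d - 3" using S d(2) by (simp add: degree_diff_le)
  \<comment> \<open>For d = 2 there are no forms of degree d - 3, so \<open>\<gamma>\<close> must
    vanish; a bound by the truncated difference d - 3 would allow constants.\<close>
  then have "\<gamma> = 0 \<or> degree \<gamma> + d \<le> 2 * d - 3"
    using P0 d(1) by (cases "\<gamma> = 0") (simp_all add: degree_mult_eq)
  moreover have "S = [:a0:] * pderiv P + (- a') * Q + \<gamma> * P"
    by (simp add: eq Q a0 algebra_simps)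
  ultimately show ?thesis using that[of "[:a0:]" "- a'" \<gamma>] a' by simp
qed

text \<open>A surviving monomial x^i y^(D-i) can be multiplied up to the socle x^(q-1) y^(q-1).
  Hence if D + k were at most 2q - 2, some monomial of degree k would keep it outside the
  ideal.\<close>

lemma frobenius_socle_bound:
  assumes G: "\<not> in_frob q D G" and mult: "\<And>j. j \<le> k \<Longrightarrow> in_frob q (D + k) (G * monom 1 j)"
  shows "2 * q \<le> D + k + 1"
proof -
  obtain i where i: "i < q" "D < i + q" "coeff G i \<noteq> 0" using G by (auto simp: in_frob_def)
  have c: "coeff (G * monom 1 j) (i + j) = coeff G i" for j
    by (subst mult.commute) (simp add: coeff_monom_mult)
  have "i + k \<ge> q"
  proof (rule ccontr)
    assume "\<not> i + k \<ge> q"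
    then have "coeff (G * monom 1 k) (i + k) = 0" using mult[of k] i by (auto simp: in_frob_def)
    then show False using c i(3) by simp
  qed
  \<comment> \<open>Multiplication by x^j y^(k-j) raises the exponent of x to q - 1, so the exponent
    D + k - (q - 1) of y must reach q.\<close>
  define j where "j = q - 1 - i"
  have "j \<le> k" "i + j = q - 1" using \<open>i + k \<ge> q\<close> i(1) by (auto simp: j_def)
  then have "\<not> D + k < i + j + q" using mult[of j] c[of j] i by (auto simp: in_frob_def)
  then show ?thesis using \<open>i + j = q - 1\<close> i(1) by auto
qed

text \<open>Differentiating P^N produces a factor N, which can be cancelled because N is nonzero in
  k. The remaining case, p dividing N, is left to the descent in
  \<open>separable_power_in_frob_bound\<close>.\<close>

lemma separable_power_bound:
  fixes P A0 B0 :: "'a::field poly"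
  assumes d: "d = degree P" "d \<ge> 2" and bezout: "A0 * P + B0 * pderiv P = 1"
    and q: "of_nat q = (0 :: 'a)" and N: "of_nat N \<noteq> (0 :: 'a)"
    and PN: "in_frob q (N * d) (P ^ N)" and G: "\<not> in_frob q ((N - 1) * d) (P ^ (N - 1))"
  shows "2 * q + 2 \<le> N * d + d"
proof -
  define Q where "Q = smult (of_nat (degree P)) P - pCons 0 (pderiv P)"
  define g where "g = P ^ (N - 1)"
  obtain M where M: "N = Suc M" using N by (cases N) auto
  have gP: "g * P = P ^ N" by (simp add: g_def M)
  have pd: "pderiv (P ^ N) = smult (of_nat N) (g * pderiv P)"
    by (simp add: M g_def pderiv_power_Suc del: of_nat_Suc power_Suc)
  obtain D where D: "N * d = Suc D" using d(2) M by (cases "N * d") auto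
  have PN': "in_frob q (Suc D) (P ^ N)" using PN by (simp add: D)
  have "in_frob q D (smult (inverse (of_nat N)) (pderiv (P ^ N)))"
    by (rule in_frob_smult[OF in_frob_pderiv[OF q PN']])
  then have 1: "in_frob q D (g * pderiv P)" using N by (simp add: pd)
  have "smult (of_nat (Suc D)) (P ^ N) - pCons 0 (pderiv (P ^ N)) = smult (of_nat N) (g * Q)"
  proof -
    have "smult (of_nat (Suc D)) (P ^ N) = smult (of_nat N) (g * smult (of_nat d) P)"
      unfolding gP[symmetric] D[symmetric] by simp
    moreover have "pCons 0 (pderiv (P ^ N)) = smult (of_nat N) (g * pCons 0 (pderiv P))"
      unfolding pd by simp
    moreover have "g * Q = g * smult (of_nat d) P - g * pCons 0 (pderiv P)"
      unfolding Q_def d(1) by (rule right_diff_distrib)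
    ultimately show ?thesis by (simp only: smult_diff_right)
  qed
  moreover have "in_frob q D (smult (inverse (of_nat N)) (smult (of_nat (Suc D)) (P ^ N) - pCons 0 (pderiv (P ^ N))))"
    by (rule in_frob_smult[OF in_frob_pderiv_dual[OF q PN']])
  ultimately have 2: "in_frob q D (g * Q)" using N by (simp del: of_nat_Suc)
  \<comment> \<open>With D = N d - 1 and M = N - 1: a multiple of g F_x or g F_y by a form of degree
    d - 2 has the same degree as g times a form of degree 2 d - 3.\<close>
  have deg: "D + (d - 2) = M * d + (2 * d - 3)" using D d(2) M by auto
  have "in_frob q (M * d + (2 * d - 3)) (g * monom 1 j)" if j: "j \<le> 2 * d - 3" for j
  proof -
    have "degree (monom 1 j :: 'a poly) \<le> 2 * d - 3" using j by (simp add: degree_monom_eq)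
    then obtain \<alpha> \<beta> \<gamma> where abc: "monom 1 j = \<alpha> * pderiv P + \<beta> * Q + \<gamma> * P"
      "degree \<alpha> \<le> d - 2" "degree \<beta> \<le> d - 2" "\<gamma> = 0 \<or> degree \<gamma> + d \<le> 2 * d - 3"
      unfolding Q_def using jacobian_ideal_top_degree[OF d bezout] by blast
    have "in_frob q (M * d + (2 * d - 3)) ((g * pderiv P) * \<alpha>)"
      "in_frob q (M * d + (2 * d - 3)) ((g * Q) * \<beta>)"
      using in_frob_mult[OF 1 abc(2)] in_frob_mult[OF 2 abc(3)] by (simp_all add: deg)
    moreover have "in_frob q (M * d + (2 * d - 3)) (P ^ N * \<gamma>)"
      using abc(4)
    proof
      assume "degree \<gamma> + d \<le> 2 * d - 3"
      then have "degree \<gamma> \<le> d - 3" and "N * d + (d - 3) = M * d + (2 * d - 3)" using d(2) M by auto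
      then show ?thesis using in_frob_mult[OF PN, of \<gamma> "d - 3"] by simp
    qed simp
    moreover have "g * monom 1 j = (g * pderiv P) * \<alpha> + (g * Q) * \<beta> + P ^ N * \<gamma>"
      unfolding abc(1) by (simp add: algebra_simps flip: gP)
    ultimately show ?thesis by (auto intro: in_frob_add)
  qed
  moreover have "\<not> in_frob q (M * d) g" using G by (simp add: g_def M)
  ultimately have "2 * q \<le> M * d + (2 * d - 3) + 1" by (rule frobenius_socle_bound[rotated])
  then show ?thesis using d(2) M by auto
qed

section \<open>Descent through p-th powers\<close>

lemma coeff_power_CHAR:
  fixes A :: "'a::comm_ring_1 poly"
  assumes "prime CHAR('a)"
  shows "coeff (A ^ CHAR('a)) (CHAR('a) * i) = coeff A i ^ CHAR('a)"
proof -
  let ?p = "CHAR('a)"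
  have p: "?p > 0" using assms by (rule prime_gt_0_nat)
  have "A ^ ?p = (\<Sum>j\<le>degree A. monom (coeff A j) j) ^ ?p" by (simp add: poly_as_sum_of_monoms)
  also have "\<dots> = (\<Sum>j\<le>degree A. monom (coeff A j) j ^ ?p)"
    using assms by (intro freshmans_dream_sum) simp_all
  also have "\<dots> = (\<Sum>j\<le>degree A. monom (coeff A j ^ ?p) (?p * j))"
    by (simp add: monom_power mult.commute)
  finally have "coeff (A ^ ?p) (?p * i) = (\<Sum>j\<le>degree A. if j = i then coeff A j ^ ?p else 0)"
    using p by (simp add: coeff_sum if_distrib cong: if_cong)
  also have "\<dots> = coeff A i ^ ?p" using p by (auto simp: coeff_eq_0 power_0_left)
  finally show ?thesis .
qed

lemma in_frob_power_CHAR_cancel: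
  fixes A :: "'a::idom poly"
  assumes "prime CHAR('a)" "in_frob (CHAR('a) * q) (CHAR('a) * D) (A ^ CHAR('a))"
  shows "in_frob q D A"
  unfolding in_frob_def
proof (intro allI impI)
  fix i assume "i < q" "D < i + q"
  then have "CHAR('a) * i < CHAR('a) * q" "CHAR('a) * D < CHAR('a) * i + CHAR('a) * q"
    using prime_gt_0_nat[OF assms(1)] by (simp_all flip: distrib_left)
  then have "coeff (A ^ CHAR('a)) (CHAR('a) * i) = 0" using assms(2) by (simp add: in_frob_def)
  then show "coeff A i = 0" by (simp add: coeff_power_CHAR[OF assms(1)])
qed

text \<open>The constant c stays open, so that one induction serves both 1/(d - 1) and the larger
  constant behind the strict inequality; \<open>bound\<close> isolates the arithmetic that differs.
  A multiple of p is handled by passing to e - 1, which leaves the ratio N/q unchanged.\<close>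

lemma separable_power_in_frob_bound:
  fixes P A0 B0 :: "'a::field poly" and c :: real
  assumes d: "d = degree P" "d \<ge> 2" and bezout: "A0 * P + B0 * pderiv P = 1"
    and p: "p = CHAR('a)" "prime p" and c: "c \<le> 1"
    and bound: "\<And>e N. N \<ge> 1 \<Longrightarrow> 2 * p ^ e + 2 \<le> N * d + d \<Longrightarrow> c * real (p ^ e) \<le> real N"
    and N: "in_frob (p ^ e) (N * d) (P ^ N)"
  shows "c * real (p ^ e) \<le> real N"
  using N
proof (induction e arbitrary: N)
  case 0
  \<comment> \<open>For q = 1 the ideal is proper and cannot contain P^0 = 1, so N is at least 1 and
    hence at least c.\<close>
  have "N \<noteq> 0" using 0 by (auto simp: in_frob_def)
  then show ?case using c by simp
next
  case (Suc e)
  let ?Z = "\<lambda>N. in_frob (p ^ Suc e) (N * d) (P ^ N)"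
  define M where "M = (LEAST N. ?Z N)"
  have M: "?Z M" unfolding M_def by (rule LeastI[of ?Z, OF Suc.prems])
  have "M \<le> N" unfolding M_def by (rule Least_le[of ?Z, OF Suc.prems])
  have "M \<noteq> 0"
  proof
    assume "M = 0"
    then have "coeff (1 :: 'a poly) 0 = 0"
      using M[unfolded in_frob_def, rule_format, of 0] prime_gt_0_nat[OF p(2)] by simp
    then show False by simp
  qed
  have "c * real (p ^ Suc e) \<le> real M"
  proof (cases "p dvd M")
    case True
    then obtain K where K: "M = p * K" by (auto simp: dvd_def)
    have "(P ^ K) ^ p = P ^ M" by (simp add: K mult.commute flip: power_mult)
    then have "in_frob (p * p ^ e) (p * (K * d)) ((P ^ K) ^ p)" using M by (simp add: K mult.assoc)
    then have "in_frob (p ^ e) (K * d) (P ^ K)"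
      using in_frob_power_CHAR_cancel[of "p ^ e" "K * d" "P ^ K"] p by simp
    then have "c * real (p ^ e) \<le> real K" by (rule Suc.IH)
    then have "real p * (c * real (p ^ e)) \<le> real p * real K" by (intro mult_left_mono) auto
    then show ?thesis by (simp add: K mult_ac)
  next
    case False
    have "\<not> ?Z (M - 1)" using \<open>M \<noteq> 0\<close> unfolding M_def by (intro not_less_Least) auto
    moreover have "of_nat (p ^ Suc e) = (0 :: 'a)" "of_nat M \<noteq> (0 :: 'a)"
      using False p(1) by (auto simp: of_nat_eq_0_iff_char_dvd)
    ultimately have "2 * p ^ Suc e + 2 \<le> M * d + d"
      using separable_power_bound[OF d bezout _ _ M] by blast
    then show ?thesis using bound[of M "Suc e"] \<open>M \<noteq> 0\<close> by simp
  qed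
  then show ?case using \<open>M \<le> N\<close> by simp
qed

section \<open>Bounds on the F-pure threshold\<close>

lemma var_power_ideal_mult: "a \<in> var_power_ideal q \<Longrightarrow> b * a \<in> var_power_ideal q"
  unfolding var_power_ideal_def ideal_generated_by_def by (rule module.span_scale[OF module_self])

lemma var_power_ideal_sum: "(\<And>i. i \<in> I \<Longrightarrow> g i \<in> var_power_ideal q) \<Longrightarrow> sum g I \<in> var_power_ideal q"
  unfolding var_power_ideal_def ideal_generated_by_def by (rule module.span_sum[OF module_self])

lemma single_in_var_power_ideal:
  fixes m :: "'n::finite \<Rightarrow>\<^sub>0 nat" and c :: "'a::comm_ring_1"
  assumes "q \<le> Poly_Mapping.lookup m i"
  shows "Poly_Mapping.single m c \<in> var_power_ideal q"
proof -
  have "m = m - Poly_Mapping.single i q + Poly_Mapping.single i q"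
    using assms by (intro poly_mapping_eqI) (auto simp: lookup_add lookup_minus lookup_single when_def)
  then have "Poly_Mapping.single m c = Poly_Mapping.single (m - Poly_Mapping.single i q) c * var i ^ q"
    by (simp add: var_power mult_single)
  moreover have "(var i :: ('n, 'a) mpoly) ^ q \<in> var_power_ideal q"
    unfolding var_power_ideal_def ideal_generated_by_def by (rule module.span_base[OF module_self]) simp
  ultimately show ?thesis by (simp add: var_power_ideal_mult)
qed

lemma var_power_ideal_iff:
  fixes f :: "('n::finite, 'a::comm_ring_1) mpoly"
  shows "f \<in> var_power_ideal q \<longleftrightarrow> (\<forall>m\<in>Poly_Mapping.keys f. \<exists>i. q \<le> Poly_Mapping.lookup m i)"
proof
  let ?V = "{f :: ('n, 'a) mpoly. \<forall>m\<in>Poly_Mapping.keys f. \<exists>i. q \<le> Poly_Mapping.lookup m i}"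
  have "module.subspace (*) ?V"
    unfolding module.subspace_def[OF module_self]
  proof (intro conjI ballI allI)
    show "x + y \<in> ?V" if "x \<in> ?V" "y \<in> ?V" for x y
      using that Poly_Mapping.keys_add[of x y] by auto
    show "c * x \<in> ?V" if x: "x \<in> ?V" for c x
    proof (intro CollectI ballI)
      fix m assume "m \<in> Poly_Mapping.keys (c * x)"
      then obtain a b where "m = a + b" "b \<in> Poly_Mapping.keys x" using keys_mult[of c x] by auto
      moreover from this obtain i where "q \<le> Poly_Mapping.lookup b i" using x by blast
      ultimately show "\<exists>i. q \<le> Poly_Mapping.lookup m i" by (auto simp: lookup_add intro!: exI[of _ i])
    qed
  qed simp
  moreover have "range (\<lambda>i. var i ^ q) \<subseteq> ?V"
    by (auto simp: var_power) (metis lookup_single_eq order_refl)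
  ultimately have "var_power_ideal q \<subseteq> ?V"
    unfolding var_power_ideal_def ideal_generated_by_def
    by (intro module.span_minimal[OF module_self])
  then show "\<forall>m\<in>Poly_Mapping.keys f. \<exists>i. q \<le> Poly_Mapping.lookup m i" if "f \<in> var_power_ideal q"
    using that by auto
next
  assume "\<forall>m\<in>Poly_Mapping.keys f. \<exists>i. q \<le> Poly_Mapping.lookup m i"
  then have "(\<Sum>m\<in>Poly_Mapping.keys f. Poly_Mapping.single m (Poly_Mapping.lookup f m)) \<in> var_power_ideal q"
    by (intro var_power_ideal_sum) (auto intro: single_in_var_power_ideal)
  then show "f \<in> var_power_ideal q" by (simp add: poly_mapping_sum_single)
qed

lemma var_power_ideal_mono: "q \<le> r \<Longrightarrow> var_power_ideal r \<subseteq> var_power_ideal q"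
  by (fastforce simp: var_power_ideal_iff intro: order_trans)

lemma frobenius_power_expand:
  fixes f :: "('n, 'a::comm_ring_1) mpoly"
  assumes "prime CHAR('a)"
  shows "f ^ (CHAR('a) ^ e) = (\<Sum>m\<in>Poly_Mapping.keys f.
    Poly_Mapping.single (Poly_Mapping.map ((*) (CHAR('a) ^ e)) m) (Poly_Mapping.lookup f m ^ (CHAR('a) ^ e)))"
proof -
  have "f ^ (CHAR('a) ^ e) =
      (\<Sum>m\<in>Poly_Mapping.keys f. Poly_Mapping.single m (Poly_Mapping.lookup f m)) ^ (CHAR('a) ^ e)"
    by (simp add: poly_mapping_sum_single)
  also have "\<dots> = (\<Sum>m\<in>Poly_Mapping.keys f. Poly_Mapping.single m (Poly_Mapping.lookup f m) ^ (CHAR('a) ^ e))"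
    using assms by (intro freshmans_dream_sum'[where n = e]) (simp_all add: CHAR_mpoly)
  finally show ?thesis by (simp add: single_power)
qed

lemma lookup_map_times: "Poly_Mapping.lookup (Poly_Mapping.map ((*) (k::nat)) m) i = k * Poly_Mapping.lookup m i"
  by (simp add: Poly_Mapping.map.rep_eq when_def)

lemma frobenius_var_power_ideal:
  fixes f :: "('n::finite, 'a::comm_ring_1) mpoly"
  assumes "prime CHAR('a)" "f \<in> var_power_ideal q"
  shows "f ^ (CHAR('a) ^ e) \<in> var_power_ideal (CHAR('a) ^ e * q)"
  unfolding frobenius_power_expand[OF assms(1)]
proof (rule var_power_ideal_sum)
  fix m assume "m \<in> Poly_Mapping.keys f"
  then obtain i where "q \<le> Poly_Mapping.lookup m i" using assms(2) by (auto simp: var_power_ideal_iff)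
  then show "Poly_Mapping.single (Poly_Mapping.map ((*) (CHAR('a) ^ e)) m) (Poly_Mapping.lookup f m ^ CHAR('a) ^ e)
      \<in> var_power_ideal (CHAR('a) ^ e * q)"
    by (intro single_in_var_power_ideal[of _ _ i]) (simp add: lookup_map_times)
qed

lemma homogeneous_mult:
  fixes f g :: "('n::finite, 'a::comm_ring_1) mpoly"
  assumes "homogeneous_of_degree d f" "homogeneous_of_degree e g"
  shows "homogeneous_of_degree (d + e) (f * g)"
  unfolding homogeneous_of_degree_def
proof
  fix m assume "m \<in> Poly_Mapping.keys (f * g)"
  then obtain a b where "m = a + b" "a \<in> Poly_Mapping.keys f" "b \<in> Poly_Mapping.keys g"
    using keys_mult[of f g] by auto
  then show "(\<Sum>i\<in>UNIV. Poly_Mapping.lookup m i) = d + e"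
    using assms by (simp add: homogeneous_of_degree_def lookup_add sum.distrib)
qed

lemma homogeneous_power:
  fixes f :: "('n::finite, 'a::comm_ring_1) mpoly"
  assumes "homogeneous_of_degree d f"
  shows "homogeneous_of_degree (N * d) (f ^ N)"
proof (induction N)
  case (Suc N)
  then show ?case using homogeneous_mult[OF assms] by simp
qed (simp add: homogeneous_of_degree_def)

text \<open>Frobenius is additive, so (v_i + u_i T)^q = v_i^q + u_i^q T^q: the q-th power of a
  variable restricts to a combination of the two q-th powers on the plane. This is why membership
  persists under restriction.\<close>

lemma in_frob_monom_eval:
  fixes m :: "'n::finite \<Rightarrow>\<^sub>0 nat" and v u :: "'n \<Rightarrow> 'b::comm_ring_1"
  assumes char: "prime CHAR('b)" and m: "CHAR('b) ^ e \<le> Poly_Mapping.lookup m i"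
  shows "in_frob (CHAR('b) ^ e) (\<Sum>i\<in>UNIV. Poly_Mapping.lookup m i) (monom_eval (\<lambda>i. [:v i, u i:]) m)"
proof -
  define q where "q = CHAR('b) ^ e"
  define n where "n = m - Poly_Mapping.single i q"
  have mn: "m = n + Poly_Mapping.single i q"
    using m by (intro poly_mapping_eqI) (auto simp: n_def q_def lookup_add lookup_minus lookup_single when_def)
  define D where "D = (\<Sum>i\<in>UNIV. Poly_Mapping.lookup n i)"
  have "(\<Sum>i\<in>UNIV. Poly_Mapping.lookup m i) = D + q"
    by (simp add: mn lookup_add sum.distrib D_def lookup_single when_def)
  moreover have "in_frob q q ([:v i, u i:] ^ q)"
  proof -
    have "[:v i, u i:] = [:v i:] + monom (u i) 1" by (simp add: monom_altdef)
    then have "[:v i, u i:] ^ q = [:v i:] ^ q + monom (u i) 1 ^ q"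
      using char by (simp add: q_def freshmans_dream')
    also have "\<dots> = [:v i ^ q:] + monom (u i ^ q) q" by (simp add: poly_const_pow monom_power)
    finally show ?thesis by (auto simp: in_frob_def coeff_pCons split: nat.splits)
  qed
  moreover have "degree (monom_eval (\<lambda>i. [:v i, u i:]) n) \<le> D"
  proof -
    have "(\<Sum>i\<in>Poly_Mapping.keys n. Poly_Mapping.lookup n i) = D"
      unfolding D_def by (intro sum.mono_neutral_left) (auto simp: in_keys_iff)
    then show ?thesis using linear_monom_eval_degree[of v u n] by simp
  qed
  moreover have "monom_eval (\<lambda>i. [:v i, u i:]) m = [:v i, u i:] ^ q * monom_eval (\<lambda>i. [:v i, u i:]) n"
    by (simp add: mn monom_eval_add)
  ultimately show ?thesis
    using in_frob_mult[of q q "[:v i, u i:] ^ q" "monom_eval (\<lambda>i. [:v i, u i:]) n" D]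
    by (simp add: add.commute q_def)
qed

lemma in_frob_mp_eval:
  fixes f :: "('n::finite, 'a::comm_ring_1) mpoly" and \<phi> :: "'a \<Rightarrow> 'b::comm_ring_1"
  assumes "prime CHAR('b)" "homogeneous_of_degree D f" "f \<in> var_power_ideal (CHAR('b) ^ e)"
  shows "in_frob (CHAR('b) ^ e) D (mp_eval (\<lambda>c. [:\<phi> c:]) (\<lambda>i. [:v i, u i:]) f)"
  unfolding mp_eval_def
proof (rule in_frob_sum)
  fix m assume m: "m \<in> Poly_Mapping.keys f"
  then obtain i where "CHAR('b) ^ e \<le> Poly_Mapping.lookup m i" using assms(3) by (auto simp: var_power_ideal_iff)
  moreover have "(\<Sum>i\<in>UNIV. Poly_Mapping.lookup m i) = D"
    using assms(2) m by (simp add: homogeneous_of_degree_def)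
  ultimately have "in_frob (CHAR('b) ^ e) D (monom_eval (\<lambda>i. [:v i, u i:]) m)"
    using in_frob_monom_eval[OF assms(1)] by metis
  then show "in_frob (CHAR('b) ^ e) D ([:\<phi> (Poly_Mapping.lookup f m):] * monom_eval (\<lambda>i. [:v i, u i:]) m)"
    by (simp add: in_frob_smult)
qed

text \<open>For each q = p^e the largest integer N below c q violates the bound, so f^N is outside
  the ideal; these quotients N/q are at least c - 1/q and tend to c.\<close>

lemma fpt_geI:
  fixes f :: "('n::finite, 'a::field) mpoly" and c :: real
  assumes p: "prime CHAR('a)" and c: "c > 0"
    and bound: "\<And>e N. f ^ N \<in> var_power_ideal (CHAR('a) ^ e) \<Longrightarrow> c * real (CHAR('a) ^ e) \<le> real N"
  shows "fpt f \<ge> ereal c"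
  unfolding fpt_def le_Sup_iff
proof (intro allI impI)
  fix y :: ereal assume y: "y < ereal c"
  \<comment> \<open>A real substitute for y, which may be minus infinity.\<close>
  obtain z where z: "y \<le> ereal z" "z < c"
  proof (cases y)
    case (real r)
    then show ?thesis using that[of r] y by simp
  qed (use y that[of "c - 1"] in auto)
  let ?p = "CHAR('a)"
  have "real ?p > 1" using prime_gt_1_nat[OF p] by simp
  then obtain e where e: "1 / (c - z) < real ?p ^ e" using real_arch_pow by blast
  define q where "q = real ?p ^ e"
  have q: "q > 0" using \<open>real ?p > 1\<close> by (simp add: q_def)
  have "1 < (c - z) * q" using e z(2) by (simp add: q_def field_simps)
  \<comment> \<open>The ceiling minus 1, not the floor: N must be strictly below c q even when c q
    is an integer.\<close>
  define N where "N = nat (\<lceil>c * q\<rceil> - 1)"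
  have "c * q > 0" using c q by simp
  then have "\<lceil>c * q\<rceil> \<ge> 1" by linarith
  then have N: "real N < c * q" "real N \<ge> c * q - 1" unfolding N_def by linarith+
  then have "f ^ N \<notin> var_power_ideal (?p ^ e)" using bound[of N e] by (auto simp: q_def)
  moreover have "z < real N / q" using N(2) \<open>1 < (c - z) * q\<close> q by (simp add: field_simps)
  then have "y < ereal (real N / real (?p ^ e))" using z(1) by (simp add: q_def le_less_trans)
  ultimately show "\<exists>a\<in>{ereal (real N / real (?p ^ e)) |N e. f ^ N \<notin> var_power_ideal (?p ^ e)}. y < a"
    by blast
qed

text \<open>Frobenius turns f in m^[q] into f^r in m^[r q] for every power r of p. Hence a power f^N
  outside m^[r q] has N < r, while no positive power of f escapes m^[q'] when q' <= q.\<close>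

lemma fpt_le_of_mem:
  fixes f :: "('n::finite, 'a::field) mpoly"
  assumes p: "prime CHAR('a)" and f: "f \<in> var_power_ideal (CHAR('a) ^ e)"
  shows "fpt f \<le> ereal (1 / real (CHAR('a) ^ e))"
  unfolding fpt_def
proof (rule Sup_least, clarify)
  let ?p = "CHAR('a)"
  fix N e' assume N: "f ^ N \<notin> var_power_ideal (?p ^ e')"
  have p0: "?p > 0" using p by (rule prime_gt_0_nat)
  have "N * ?p ^ e \<le> ?p ^ e'"
  proof (rule ccontr)
    assume less: "\<not> N * ?p ^ e \<le> ?p ^ e'"
    show False
    proof (cases "e \<le> e'")
      case True
      define r where "r = ?p ^ (e' - e)"
      have r: "?p ^ e' = r * ?p ^ e" using True by (simp add: r_def flip: power_add)
      then have "r < N" using less p0 by simp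
      then have "f ^ N = f ^ (N - r) * f ^ r" by (simp flip: power_add)
      moreover have "f ^ r \<in> var_power_ideal (?p ^ e')"
        using frobenius_var_power_ideal[OF p f, of "e' - e"] by (simp add: r r_def)
      ultimately show False using N by (simp add: var_power_ideal_mult)
    next
      case False
      then have "?p ^ e' \<le> ?p ^ e" using p0 by (intro power_increasing) auto
      then have "f \<in> var_power_ideal (?p ^ e')" using f var_power_ideal_mono by blast
      moreover have "N \<noteq> 0" using less by (cases N) auto
      then have "f ^ N = f ^ (N - 1) * f" by (cases N) (simp_all add: mult.commute)
      ultimately show False using N by (simp add: var_power_ideal_mult)
    qed
  qed
  then have "real N * real (?p ^ e) \<le> real (?p ^ e')" by (metis of_nat_le_iff of_nat_mult)
  then show "ereal (real N / real (?p ^ e')) \<le> ereal (1 / real (?p ^ e))"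
    using p0 by (simp add: field_simps)
qed

text \<open>
  If \<open>x\<^sup>a\<close> occurs in \<open>f\<close> with all \<open>a\<^sub>i < q\<close>, then \<open>x\<^bsup>a + q a\<^esup>\<close> arises in \<open>f \<cdot> f\<^sup>q\<close> in only one way:
  \<open>m + q n = a + q a\<close> forces \<open>m \<ge> a\<close> by reduction modulo \<open>q\<close>, and \<open>m\<close> and \<open>a\<close> have equal degree.
\<close>

lemma power_Suc_notin_var_power_ideal:
  fixes f :: "('n::finite, 'a::field) mpoly"
  assumes p: "prime CHAR('a)" and q: "q = CHAR('a) ^ e"
    and hom: "homogeneous_of_degree d f" and f: "f \<notin> var_power_ideal q"
  shows "f ^ Suc q \<notin> var_power_ideal (q * q)"
proof -
  have q0: "q > 0" using prime_gt_0_nat[OF p] by (simp add: q)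
  obtain a where a: "a \<in> Poly_Mapping.keys f" "\<And>i. Poly_Mapping.lookup a i < q"
    using f by (auto simp: var_power_ideal_iff not_le)
  define b where "b = a + Poly_Mapping.map ((*) q) a"
  let ?c = "Poly_Mapping.lookup f" and ?K = "Poly_Mapping.keys f"
  have uniq: "m = a \<and> n = a" if m: "m \<in> ?K" and eq: "m + Poly_Mapping.map ((*) q) n = b" for m n
  proof -
    have eq': "Poly_Mapping.lookup m i + q * Poly_Mapping.lookup n i
        = Poly_Mapping.lookup a i + q * Poly_Mapping.lookup a i" for i
      using arg_cong[OF eq, of "\<lambda>x. Poly_Mapping.lookup x i"] by (simp add: b_def lookup_add lookup_map_times)
    have le: "Poly_Mapping.lookup a i \<le> Poly_Mapping.lookup m i" for i
    proof -
      have "Poly_Mapping.lookup m i mod q = Poly_Mapping.lookup a i mod q"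
        using arg_cong[OF eq'[of i], of "\<lambda>x. x mod q"] by simp
      then have "Poly_Mapping.lookup m i mod q = Poly_Mapping.lookup a i" using a(2)[of i] by simp
      then show ?thesis by (metis mod_less_eq_dividend)
    qed
    have "(\<Sum>i\<in>UNIV. Poly_Mapping.lookup a i) = (\<Sum>i\<in>UNIV. Poly_Mapping.lookup m i)"
      using hom a(1) m by (simp add: homogeneous_of_degree_def)
    then have ma: "Poly_Mapping.lookup a i = Poly_Mapping.lookup m i" for i
      using sum_mono_inv[of "Poly_Mapping.lookup a" UNIV "Poly_Mapping.lookup m" i] le by auto
    then have "Poly_Mapping.lookup n i = Poly_Mapping.lookup a i" for i using eq'[of i] q0 by simp
    then show ?thesis using ma by (auto intro: poly_mapping_eqI)
  qed
  have "f ^ Suc q = (\<Sum>m\<in>?K. Poly_Mapping.single m (?c m)) *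
      (\<Sum>n\<in>?K. Poly_Mapping.single (Poly_Mapping.map ((*) q) n) (?c n ^ q))"
    using frobenius_power_expand[OF p, of f e] by (simp add: q poly_mapping_sum_single)
  also have "\<dots> = (\<Sum>m\<in>?K. \<Sum>n\<in>?K. Poly_Mapping.single (m + Poly_Mapping.map ((*) q) n) (?c m * ?c n ^ q))"
    by (simp add: sum_product mult_single)
  finally have "Poly_Mapping.lookup (f ^ Suc q) b =
      (\<Sum>m\<in>?K. \<Sum>n\<in>?K. if m = a \<and> n = a then ?c m * ?c n ^ q else 0)"
    unfolding lookup_sum
    by (simp only: lookup_sum lookup_single when_def) (intro sum.cong refl, use uniq in \<open>auto simp: b_def\<close>)
  also have "\<dots> = (\<Sum>m\<in>?K. if m = a then ?c m * ?c a ^ q else 0)"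
    using a(1) by (intro sum.cong) (auto simp: if_distrib cong: if_cong)
  also have "\<dots> = ?c a * ?c a ^ q" using a(1) by simp
  finally have "Poly_Mapping.lookup (f ^ Suc q) b \<noteq> 0" using a(1) by (simp add: in_keys_iff)
  then have "b \<in> Poly_Mapping.keys (f ^ Suc q)" by (simp add: in_keys_iff)
  moreover have "Poly_Mapping.lookup b i < q * q" for i
  proof -
    have "Suc (Poly_Mapping.lookup a i) \<le> q" using a(2)[of i] by simp
    then have "q * Suc (Poly_Mapping.lookup a i) \<le> q * q" by (rule mult_le_mono2)
    then show ?thesis using a(2)[of i] by (simp add: b_def lookup_add lookup_map_times)
  qed
  ultimately show ?thesis by (auto simp: var_power_ideal_iff not_le)
qed

text \<open>The bridge from f to binary forms: the line is chosen over the algebraic closure, where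
  reducedness is assumed, and the univariate bound is applied to the restriction of f.\<close>

lemma power_mem_imp_bound:
  fixes f :: "('n::finite, 'a::field) mpoly" and c :: real
  assumes char: "prime CHAR('a)" and d: "d \<ge> 2" and hom: "homogeneous_of_degree d f"
    and red: "reduced_over_alg_closure f" and c: "c \<le> 1"
    and bound: "\<And>e N. N \<ge> 1 \<Longrightarrow> 2 * CHAR('a) ^ e + 2 \<le> N * d + d \<Longrightarrow> c * real (CHAR('a) ^ e) \<le> real N"
    and mem: "f ^ N \<in> var_power_ideal (CHAR('a) ^ e)"
  shows "c * real (CHAR('a) ^ e) \<le> real N"
proof -
  define F where "F = Poly_Mapping.map to_ac f"
  have lookup_F: "Poly_Mapping.lookup F m = to_ac (Poly_Mapping.lookup f m)" for m
    by (simp add: F_def Poly_Mapping.map.rep_eq when_def)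
  then have keys_F: "Poly_Mapping.keys F = Poly_Mapping.keys f" by (auto simp: in_keys_iff)
  have "homogeneous_of_degree d F" using hom by (simp add: homogeneous_of_degree_def keys_F)
  moreover have "\<not> g ^ 2 dvd F" if "irreducible g" for g :: "('n, 'a alg_closure) mpoly"
    using red that by (auto simp: reduced_over_alg_closure_def F_def)
  moreover have "CHAR('a alg_closure) > 0" using prime_gt_0_nat[OF char] by simp
  ultimately obtain v u A B where line: "degree (on_line v u F) = d"
    "A * on_line v u F + B * pderiv (on_line v u F) = 1"
    using separable_line[of d F] by blast
  \<comment> \<open>Extension of scalars and restriction to the line in one homomorphism, so that
    powers of f are transported directly.\<close>
  define L where "L = mp_eval (\<lambda>c. [:to_ac c:]) (\<lambda>i. [:v i, u i:])"
  have "ring_hom_fun (\<lambda>c :: 'a. [:to_ac c:])"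
    by (rule ring_hom_fun_comp[OF ring_hom_fun_const_poly]) (standard, auto)
  then interpret L: ring_hom_fun L unfolding L_def by (rule ring_hom_fun_mp_eval)
  have LF: "on_line v u F = L f" by (simp add: on_line_def L_def mp_eval_def keys_F lookup_F)
  have "in_frob (CHAR('a alg_closure) ^ e) (N * d) (L (f ^ N))"
    unfolding L_def using char mem homogeneous_power[OF hom]
    by (intro in_frob_mp_eval) simp_all
  then have "in_frob (CHAR('a) ^ e) (N * d) (L f ^ N)" by (simp add: L.hom_power)
  then show ?thesis
    using separable_power_in_frob_bound[of d "L f" A B "CHAR('a)" c e N] line char d c bound
    unfolding LF by simp
qed

section \<open>The lower bound and the case of equality\<close>

lemma fpt_lower_bound:
  fixes f :: "('n::finite, 'a::field) mpoly"
  assumes char: "prime CHAR('a)" and d: "d \<ge> 2" and hom: "homogeneous_of_degree d f"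
    and red: "reduced_over_alg_closure f"
  shows "fpt f \<ge> ereal (1 / (real d - 1))"
proof (rule fpt_geI[OF char])
  show "1 / (real d - 1) > 0" using d by simp
  fix e N assume mem: "f ^ N \<in> var_power_ideal (CHAR('a) ^ e)"
  have key: "1 / (real d - 1) * real q \<le> real N" if N: "N \<ge> 1" "2 * q + 2 \<le> N * d + d" for q N :: nat
  proof -
    \<comment> \<open>The difference between 2 N (d - 1) + 2 and N d + d is exactly (N - 1)(d - 2),
      which converts the hypothesis into q <= N (d - 1).\<close>
    have "0 \<le> (real N - 1) * (real d - 2)" using N(1) d by simp
    moreover have "real (2 * q + 2) \<le> real (N * d + d)" using N(2) by (simp only: of_nat_le_iff)
    ultimately have "real q \<le> real N * (real d - 1)" by (simp add: algebra_simps)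
    then show ?thesis using d by (simp add: field_simps)
  qed
  show "1 / (real d - 1) * real (CHAR('a) ^ e) \<le> real N"
    by (rule power_mem_imp_bound[OF char d hom red _ key mem]) (use d in simp_all)
qed

text \<open>Since q never equals d - 1, either q >= d, where the bound from the socle is the
  stronger one, or q <= d - 2, where N >= 1 suffices. Both stay away from 1/(d - 1)
  uniformly.\<close>

lemma fpt_strict_lower_bound:
  fixes f :: "('n::finite, 'a::field) mpoly"
  assumes char: "prime CHAR('a)" and d: "d \<ge> 3" and hom: "homogeneous_of_degree d f"
    and red: "reduced_over_alg_closure f" and nq: "\<And>e. d \<noteq> CHAR('a) ^ e + 1"
  shows "fpt f > ereal (1 / (real d - 1))"
proof -
  \<comment> \<open>The bound (2q + 2 - d)/(d q) on N/q increases with q; c is its value at q = d.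
    It also lies below 1/(d - 2), because (d + 2)(d - 2) < d^2.\<close>
  define c where "c = (real d + 2) / (real d * real d)"
  have d': "real d \<ge> 3" using d by simp
  have less: "1 / (real d - 1) < c" unfolding c_def using d' by (simp add: field_simps)
  have "c > 0" unfolding c_def using d' by simp
  have "c \<le> 1"
  proof -
    have "real d * 3 \<le> real d * real d" using d' by (intro mult_left_mono) auto
    then have "real d + 2 \<le> real d * real d" using d' by linarith
    then show ?thesis unfolding c_def using d' by (simp add: field_simps)
  qed
  have key: "c * real q \<le> real N"
    if N: "N \<ge> 1" "2 * q + 2 \<le> N * d + d" and q: "q \<noteq> d - 1" for q N :: nat
  proof -
    have "(real d + 2) * real q \<le> real N * (real d * real d)"
    proof (cases "q \<ge> d")
      case True
      have "real (2 * q + 2) \<le> real (N * d + d)" using N(2) by (simp only: of_nat_le_iff)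
      then have "(2 * real q + 2 - real d) * real d \<le> (real N * real d) * real d"
        using d' by (intro mult_right_mono) auto
      moreover have "0 \<le> (real q - real d) * (real d - 2)" using True d' by simp
      ultimately show ?thesis by (simp add: algebra_simps)
    next
      case False
      then have "real q \<le> real d - 2" using q d by linarith
      then have "(real d + 2) * real q \<le> (real d + 2) * (real d - 2)" using d' by (intro mult_left_mono) auto
      also have "\<dots> \<le> 1 * (real d * real d)" by (simp add: algebra_simps)
      also have "\<dots> \<le> real N * (real d * real d)" using N(1) by (intro mult_right_mono) auto
      finally show ?thesis .
    qed
    then show ?thesis unfolding c_def using d' by (simp add: field_simps)
  qed
  have ne: "CHAR('a) ^ e \<noteq> d - 1" for e using nq[of e] d by arith
  have "c * real (CHAR('a) ^ e) \<le> real N" if "f ^ N \<in> var_power_ideal (CHAR('a) ^ e)" for e N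
    by (rule power_mem_imp_bound[OF char _ hom red \<open>c \<le> 1\<close> key[OF _ _ ne] that]) (use d in simp_all)
  then have "fpt f \<ge> ereal c" using \<open>c > 0\<close> by (intro fpt_geI[OF char])
  then show ?thesis using less by (metis less_ereal.simps(1) less_le_trans)
qed

theorem theorem1p1:
  fixes f :: "('n::finite, 'a::field) mpoly" and p d :: nat
  assumes "CHAR('a) = p" and "p > 0"
    and "d \<ge> 2" and "homogeneous_of_degree d f"
    and "reduced_over_alg_closure f"
  shows "fpt f \<ge> ereal (1 / (real d - 1)) \<and>
    (fpt f = ereal (1 / (real d - 1)) \<longleftrightarrow>
      (\<exists>e::nat. d = p ^ e + 1 \<and> f \<in> var_power_ideal (p ^ e)))"
proof (intro conjI iffI)
  have prime: "prime CHAR('a)" using assms(1,2) prime_CHAR_semidom by metis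
  note lower = fpt_lower_bound[OF prime assms(3-5)]
  show "fpt f \<ge> ereal (1 / (real d - 1))" by (rule lower)
  show "fpt f = ereal (1 / (real d - 1))" if "\<exists>e. d = p ^ e + 1 \<and> f \<in> var_power_ideal (p ^ e)"
  proof -
    obtain e where e: "d = p ^ e + 1" "f \<in> var_power_ideal (p ^ e)" using \<open>\<exists>e. _\<close> by blast
    then have "fpt f \<le> ereal (1 / (real d - 1))"
      using fpt_le_of_mem[OF prime, of f e] assms(1) by simp
    then show ?thesis using lower by (rule antisym)
  qed
  assume eq: "fpt f = ereal (1 / (real d - 1))"
  obtain e where e: "d = p ^ e + 1"
  proof (cases "d = 2")
    case True
    \<comment> \<open>The quadratic case belongs to q = p^0 = 1 in every characteristic.\<close>
    then show ?thesis using that[of 0] by simp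
  next
    case False
    then have "d \<ge> 3" using assms(3) by simp
    then show ?thesis
      using fpt_strict_lower_bound[OF prime _ assms(4,5)] eq that assms(1) by force
  qed
  define q where "q = p ^ e"
  have q: "q > 0" "real d - 1 = real q" using e assms(2) by (auto simp: q_def)
  have "f \<in> var_power_ideal q"
  proof (rule ccontr)
    assume "f \<notin> var_power_ideal q"
    then have "f ^ Suc q \<notin> var_power_ideal (q * q)"
      using power_Suc_notin_var_power_ideal[OF prime _ assms(4)] assms(1) by (auto simp: q_def)
    moreover have qq: "q * q = CHAR('a) ^ (e + e)" by (simp add: q_def assms(1) power_add)
    \<comment> \<open>The pair N = q + 1 and p^(2e) = q^2 enters the supremum, and (q + 1)/q^2
      exceeds 1/q.\<close>
    ultimately have "ereal (real (Suc q) / real (q * q)) \<le> fpt f"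
      unfolding fpt_def by (intro Sup_upper) (auto simp only: qq)
    then have "real (Suc q) / real (q * q) \<le> 1 / real q" by (simp add: eq q(2))
    then show False using q(1) by (simp add: field_simps)
  qed
  then show "\<exists>e. d = p ^ e + 1 \<and> f \<in> var_power_ideal (p ^ e)" using e by (auto simp: q_def)
qed

end
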